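(* Let $n\geq 1$ and let $T$ be a tree with $n$ vertices. For every partition $\lambda\vdash n$ let $c_\lambda(T)$ be the coefficient of the power-sum symmetric function $p_\lambda$ in the chromatic symmetric function ${\mathbf X}_T$. Then $$ {\mathbf K}_T(x,y) ~=~ \sum_{a>0} \sum_{b\geq 0} x^a y^b \sum_{\lambda\vdash n} \psi(\lambda,a,b)\, c_\lambda(T) $$ and $$ {\mathbf S}_T(q,r) ~=~ \sum_{i=1}^{n-1} \sum_{j=1}^i q^i r^j \sum_{\lambda\vdash n} \phi(\lambda,i,j)\, c_\lambda(T), $$ where for a partition $\lambda=(\lambda_1\geq\cdots\geq\lambda_\ell)\vdash n$ and integers $a,b,i,j$, $$\psi(\lambda,a,b) = (-1)^{a+b} \binom{\ell-1}{\ell-n+a+b} \sum_{k=1}^{\ell} \binom{\lambda_k-1}{a},$$ $$\phi(\lambda,i,j) = (-1)^{i+j} \binom{\ell-1}{\ell-n+i} \sum_{d=1}^j (-1)^d \binom{i-d}{j-d} \sum_{k=1}^\ell \binom{\lambda_k-1}{d}.$$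
   Context: All graphs are finite and simple. For a graph $G$, a proper coloring is a map $\kappa:V(G)\to\{1,2,3,\dots\}$ with $\kappa(v)\neq\kappa(w)$ whenever $v,w$ are adjacent; the chromatic symmetric function is ${\mathbf X}_G=\sum_\kappa\prod_{v\in V(G)}x_{\kappa(v)}$ (sum over all proper colorings, in commuting indeterminates $x_1,x_2,\dots$), a homogeneous symmetric function of degree $n=\#V(G)$. Here $p_k=\sum_i x_i^k$ and $p_\lambda=\prod_k p_{\lambda_k}$; the $p_\lambda$, $\lambda\vdash n$, form a basis of degree-$n$ symmetric functions over $\mathbb Q$, and $\ell$ denotes the length (number of parts) of $\lambda$. Binomial coefficients $\binom{m}{k}$ are zero when $k<0$ or $k>m$ (for $m\ge 0$). For a tree $T$, identify subtrees with their edge sets. The subtree polynomial is ${\mathbf S}_T(q,r)=\sum_S q^{\#S} r^{\#L(S)}$, summed over all subtrees $S$ of $T$ with at least one edge, where $\#S$ is the number of edges of $S$ and $L(S)$ is the set of leaf edges of $S$ (edges incident to a vertex of degree 1 in $S$). For a nonempty $A\subseteq E(T)$, the connector $K(A)$ is the unique minimal subset of $E(T)\setminus A$ such that $A\cup K(A)$ is (the edge set of) a tree. The connector polynomial is ${\mathbf K}_T(x,y)=\sum_{\emptyset\neq A\subseteq E(T)} x^{\#A}y^{\#K(A)}$. *)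

theory Defs
  imports
    "HOL-Library.Multiset"
    "HOL-Library.FuncSet"
    "HOL-Library.Poly_Mapping"
    "HOL-Computational_Algebra.Polynomial"
begin

section \<open>Formal power series in infinitely many variables\<close>

text \<open>
  A monomial in the commuting variables \<open>x\<^sub>i\<close> is its finitely supported exponent vector, and a
  formal power series over the rationals is an arbitrary assignment of coefficients to monomials.
\<close>

type_synonym monomial = "nat \<Rightarrow>\<^sub>0 nat"

typedef power_series = "UNIV :: (monomial \<Rightarrow> rat) set"
  morphisms ps_coeff Abs_power_series ..

setup_lifting type_definition_power_series

lemma power_series_eqI: "(\<And>m. ps_coeff f m = ps_coeff g m) \<Longrightarrow> f = g"
  by transfer blast

lemma finite_monomial_divisors: "finite {a :: monomial. \<exists>b. a + b = m}"
proof -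
  define K where "K = Poly_Mapping.keys m"
  define M where "M = Max (insert 0 (Poly_Mapping.lookup m ` K))"
  let ?F = "{f. \<forall>i. (i \<in> K \<longrightarrow> f i \<in> {..M}) \<and> (i \<notin> K \<longrightarrow> f i = (0 :: nat))}"
  have "finite ?F"
    by (rule finite_set_of_finite_funs) (simp_all add: K_def)
  moreover have "Poly_Mapping.lookup ` {a :: monomial. \<exists>b. a + b = m} \<subseteq> ?F"
  proof -
    have le: "Poly_Mapping.lookup a i \<le> Poly_Mapping.lookup m i" if "a + b = m" for a b i
      using that by (auto simp: lookup_add)
    have M: "Poly_Mapping.lookup m i \<le> M" if "i \<in> K" for i
      unfolding M_def using that by (intro Max_ge) (auto simp: K_def)
    have zero: "Poly_Mapping.lookup m i = 0" if "i \<notin> K" for i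
      using that by (simp add: K_def in_keys_iff)
    have "Poly_Mapping.lookup a i \<le> M" if "a + b = m" "i \<in> K" for a b i
      using le[OF that(1)] M[OF that(2)] by (rule le_trans)
    moreover have "Poly_Mapping.lookup a i = 0" if "a + b = m" "i \<notin> K" for a b i
      using le[OF that(1), of i] zero[OF that(2)] by simp
    ultimately show ?thesis
      unfolding image_subset_iff mem_Collect_eq atMost_iff by blast
  qed
  ultimately have "finite (Poly_Mapping.lookup ` {a :: monomial. \<exists>b. a + b = m})"
    by (rule rev_finite_subset)
  then show ?thesis
    by (rule finite_imageD) (simp add: inj_on_def poly_mapping_eqI)
qed

lemma finite_monomial_splittings: "finite {(a, b :: monomial). a + b = m}"
proof (rule finite_subset)
  show "{(a, b). a + b = m} \<subseteq> (\<lambda>a. (a, m - a)) ` {a. \<exists>b. a + b = m}"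
    by auto
qed (simp add: finite_monomial_divisors)

instantiation power_series :: comm_ring_1
begin

lift_definition zero_power_series :: power_series is "\<lambda>m. 0" .

lift_definition one_power_series :: power_series is "\<lambda>m. if m = 0 then 1 else 0" .

lift_definition plus_power_series :: "power_series \<Rightarrow> power_series \<Rightarrow> power_series"
  is "\<lambda>f g m. f m + g m" .

lift_definition minus_power_series :: "power_series \<Rightarrow> power_series \<Rightarrow> power_series"
  is "\<lambda>f g m. f m - g m" .

lift_definition uminus_power_series :: "power_series \<Rightarrow> power_series"
  is "\<lambda>f m. - f m" .

lift_definition times_power_series :: "power_series \<Rightarrow> power_series \<Rightarrow> power_series"
  is "\<lambda>f g m. \<Sum>(a, b) | a + b = m. f a * g b" .

instance
proof
  fix f g h :: power_series
  show "f * g * h = f * (g * h)"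
  proof transfer
    fix f g h :: "monomial \<Rightarrow> rat"
    have "(\<Sum>(a, b) | a + b = m. (\<Sum>(a', b') | a' + b' = a. f a' * g b') * h b) =
        (\<Sum>(a, b) | a + b = m. f a * (\<Sum>(a', b') | a' + b' = b. g a' * h b'))" for m
    proof -
      let ?A = "{(a, b :: monomial). a + b = m}"
      let ?B = "\<lambda>m. {(a, b :: monomial). a + b = m}"
      have "(\<Sum>(a, b) | a + b = m. (\<Sum>(a', b') | a' + b' = a. f a' * g b') * h b) =
          (\<Sum>p \<in> ?A. \<Sum>q \<in> ?B (fst p). f (fst q) * g (snd q) * h (snd p))"
        by (simp add: sum_distrib_right split_beta)
      also have "\<dots> = (\<Sum>(p, q) \<in> (SIGMA p : ?A. ?B (fst p)). f (fst q) * g (snd q) * h (snd p))"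
        by (rule sum.Sigma) (use finite_monomial_splittings in auto)
      also have "\<dots> = (\<Sum>(p, q) \<in> (SIGMA p : ?A. ?B (snd p)). f (fst p) * (g (fst q) * h (snd q)))"
        by (rule sum.reindex_bij_witness
              [where i = "\<lambda>((a, b), (c, d)). ((a + c, d), (a, c))"
                 and j = "\<lambda>((a, b), (c, d)). ((c, d + b), (d, b))"])
          (auto simp: algebra_simps)
      also have "\<dots> = (\<Sum>p \<in> ?A. \<Sum>q \<in> ?B (snd p). f (fst p) * (g (fst q) * h (snd q)))"
        by (rule sum.Sigma[symmetric]) (use finite_monomial_splittings in auto)
      also have "\<dots> = (\<Sum>(a, b) | a + b = m. f a * (\<Sum>(a', b') | a' + b' = b. g a' * h b'))"
        by (simp add: sum_distrib_left split_beta)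
      finally show ?thesis .
    qed
    then show "(\<lambda>m. \<Sum>(a, b) | a + b = m. (\<Sum>(a', b') | a' + b' = a. f a' * g b') * h b) =
        (\<lambda>m. \<Sum>(a, b) | a + b = m. f a * (\<Sum>(a', b') | a' + b' = b. g a' * h b'))"
      by blast
  qed
  show "f * g = g * f"
  proof transfer
    fix f g :: "monomial \<Rightarrow> rat"
    have "(\<Sum>(a, b) | a + b = m. f a * g b) = (\<Sum>(a, b) | a + b = m. g a * f b)" for m
      by (rule sum.reindex_bij_witness[where i = prod.swap and j = prod.swap])
        (auto simp: algebra_simps)
    then show "(\<lambda>m. \<Sum>(a, b) | a + b = m. f a * g b) = (\<lambda>m. \<Sum>(a, b) | a + b = m. g a * f b)"
      by blast
  qed
  show "1 * f = f"
  proof transfer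
    fix f :: "monomial \<Rightarrow> rat"
    have "(\<Sum>(a, b) | a + b = m. (if a = 0 then 1 else 0) * f b) = f m" for m
    proof -
      have "(\<Sum>(a, b) | a + b = m. (if a = 0 then 1 else 0) * f b) =
          (\<Sum>(a, b) \<in> {(0 :: monomial, m)}. (if a = 0 then 1 else 0) * f b)"
        by (rule sum.mono_neutral_right[OF finite_monomial_splittings])
          (auto split: if_splits)
      then show ?thesis by simp
    qed
    then show "(\<lambda>m. \<Sum>(a, b) | a + b = m. (if a = 0 then 1 else 0) * f b) = f"
      by blast
  qed
  show "(f + g) * h = f * h + g * h"
    by transfer (simp add: fun_eq_iff sum.distrib split_beta algebra_simps)
  show "(0 :: power_series) \<noteq> 1"
    by transfer (metis zero_neq_one)
qed (transfer; simp add: fun_eq_iff)+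

end

lift_definition ps_scale :: "rat \<Rightarrow> power_series \<Rightarrow> power_series" is "\<lambda>c f m. c * f m" .

text \<open>
  The formal sum of the family of monomials \<open>(u i)\<close>, \<open>i \<in> I\<close>; it is meaningful only if each monomial
  occurs finitely often in the family.
\<close>

definition monomial_sum :: "'i set \<Rightarrow> ('i \<Rightarrow> monomial) \<Rightarrow> power_series"
  where "monomial_sum I u = Abs_power_series (\<lambda>m. of_nat (card {i \<in> I. u i = m}))"


section \<open>Partitions and power sums\<close>

text \<open>An integer partition is the multiset of its parts; its length is the size of the multiset.\<close>

definition partitions :: "nat \<Rightarrow> nat multiset set"
  where "partitions n = {lam. 0 \<notin># lam \<and> sum_mset lam = n}"

text \<open>Only the variables \<open>x\<^sub>1, x\<^sub>2, \<dots>\<close> are used; \<open>x\<^sub>0\<close> never occurs.\<close>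

definition power_sum :: "nat \<Rightarrow> power_series"
  where "power_sum k = monomial_sum {1..} (\<lambda>i. Poly_Mapping.single i k)"

definition power_sum_partition :: "nat multiset \<Rightarrow> power_series"
  where "power_sum_partition lam = (\<Prod>k\<in>#lam. power_sum k)"

definition power_sum_coeff :: "nat \<Rightarrow> power_series \<Rightarrow> nat multiset \<Rightarrow> rat"
  where "power_sum_coeff n f =
    (THE c. (\<forall>lam. lam \<notin> partitions n \<longrightarrow> c lam = 0) \<and>
            f = (\<Sum>lam\<in>partitions n. ps_scale (c lam) (power_sum_partition lam)))"

lemma size_le_sum_mset: "0 \<notin># lam \<Longrightarrow> size lam \<le> sum_mset (lam :: nat multiset)"
  by (induction lam) auto

lemma finite_partitions: "finite (partitions n)"
proof (rule finite_subset)
  show "partitions n \<subseteq> (\<Union>k\<in>{..n}. multisets_of_size {..n} k)"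
  proof
    fix lam assume lam: "lam \<in> partitions n"
    then have "size lam \<le> n"
      using size_le_sum_mset by (auto simp: partitions_def)
    moreover have "set_mset lam \<subseteq> {..n}"
    proof
      fix k assume "k \<in># lam"
      then obtain mu where "lam = add_mset k mu"
        by (metis insert_DiffM)
      with lam show "k \<in> {..n}"
        by (auto simp: partitions_def)
    qed
    ultimately show "lam \<in> (\<Union>k\<in>{..n}. multisets_of_size {..n} k)"
      by (auto simp: multisets_of_size_def)
  qed
qed auto


section \<open>Graphs, trees, and the chromatic symmetric function\<close>

definition simple_graph :: "'a set \<Rightarrow> 'a set set \<Rightarrow> bool"
  where "simple_graph V E \<longleftrightarrow> finite V \<and> (\<forall>e\<in>E. e \<subseteq> V \<and> card e = 2)"

definition connected_graph :: "'a set \<Rightarrow> 'a set set \<Rightarrow> bool"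
  where "connected_graph V E \<longleftrightarrow>
    V \<noteq> {} \<and> (\<forall>u\<in>V. \<forall>v\<in>V. (u, v) \<in> {(x, y). {x, y} \<in> E}\<^sup>*)"

definition graph_cycle :: "'a set set \<Rightarrow> 'a list \<Rightarrow> bool"
  where "graph_cycle E vs \<longleftrightarrow> 3 \<le> length vs \<and> distinct vs \<and>
    (\<forall>i < length vs. {vs ! i, vs ! (Suc i mod length vs)} \<in> E)"

definition is_tree :: "'a set \<Rightarrow> 'a set set \<Rightarrow> bool"
  where "is_tree V E \<longleftrightarrow> simple_graph V E \<and> connected_graph V E \<and> (\<nexists>vs. graph_cycle E vs)"

definition proper_colorings :: "'a set \<Rightarrow> 'a set set \<Rightarrow> ('a \<Rightarrow> nat) set"
  where "proper_colorings V E =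
    {\<kappa> \<in> V \<rightarrow>\<^sub>E {1..}. \<forall>v\<in>V. \<forall>w\<in>V. {v, w} \<in> E \<longrightarrow> \<kappa> v \<noteq> \<kappa> w}"

definition chromatic_symmetric_function :: "'a set \<Rightarrow> 'a set set \<Rightarrow> power_series"
  where "chromatic_symmetric_function V E =
    monomial_sum (proper_colorings V E) (\<lambda>\<kappa>. \<Sum>v\<in>V. Poly_Mapping.single (\<kappa> v) 1)"


section \<open>Subtree and connector polynomials\<close>

text \<open>
  Subtrees with at least one edge are identified with their edge sets; the vertex set of such a
  subtree is the union of its edges.
\<close>

definition tree_edge_set :: "'a set set \<Rightarrow> bool"
  where "tree_edge_set S \<longleftrightarrow> S \<noteq> {} \<and> is_tree (\<Union>S) S"

definition leaf_edges :: "'a set set \<Rightarrow> 'a set set"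
  where "leaf_edges S = {e \<in> S. \<exists>v\<in>e. card {e' \<in> S. v \<in> e'} = 1}"

definition connector :: "'a set set \<Rightarrow> 'a set set \<Rightarrow> 'a set set"
  where "connector E A =
    (THE K. K \<subseteq> E - A \<and> tree_edge_set (A \<union> K) \<and>
            \<not> (\<exists>K'. K' \<subset> K \<and> tree_edge_set (A \<union> K')))"

text \<open>
  Bivariate polynomials are polynomials in the first variable whose coefficients are polynomials
  in the second variable: \<open>bivariate_monom c a b\<close> is \<open>c x\<^sup>a y\<^sup>b\<close>.
\<close>

definition bivariate_monom :: "rat \<Rightarrow> nat \<Rightarrow> nat \<Rightarrow> rat poly poly"
  where "bivariate_monom c a b = monom (monom c b) a"

definition subtree_poly :: "'a set set \<Rightarrow> rat poly poly"
  where "subtree_poly E =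
    (\<Sum>S | S \<subseteq> E \<and> tree_edge_set S. bivariate_monom 1 (card S) (card (leaf_edges S)))"

definition connector_poly :: "'a set set \<Rightarrow> rat poly poly"
  where "connector_poly E =
    (\<Sum>A | A \<subseteq> E \<and> A \<noteq> {}. bivariate_monom 1 (card A) (card (connector E A)))"


section \<open>The coefficients \<open>\<psi>\<close> and \<open>\<phi>\<close>\<close>

definition int_binomial :: "int \<Rightarrow> int \<Rightarrow> rat"
  where "int_binomial m k = (if 0 \<le> k \<and> k \<le> m then of_nat (nat m choose nat k) else 0)"

definition psi :: "nat multiset \<Rightarrow> int \<Rightarrow> int \<Rightarrow> rat"
  where "psi lam a b =
    (let n = int (sum_mset lam); l = int (size lam) in
     (-1) powi (a + b) * int_binomial (l - 1) (l - n + a + b) *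
       (\<Sum>p\<in>#lam. int_binomial (int p - 1) a))"

definition phi :: "nat multiset \<Rightarrow> int \<Rightarrow> int \<Rightarrow> rat"
  where "phi lam i j =
    (let n = int (sum_mset lam); l = int (size lam) in
     (-1) powi (i + j) * int_binomial (l - 1) (l - n + i) *
       (\<Sum>d = 1..j. (-1) powi d * int_binomial (i - d) (j - d) *
         (\<Sum>p\<in>#lam. int_binomial (int p - 1) d)))"

text \<open>The infinite double sum over \<open>a > 0\<close> and \<open>b \<ge> 0\<close> has finite support:\<close>

lemma psi_eq_0: "lam \<in> partitions n \<Longrightarrow> int n \<le> a + b \<Longrightarrow> psi lam a b = 0"
  by (simp add: psi_def int_binomial_def partitions_def)

end

theory Submission
  imports Defs
begin

text \<open>
  Inclusion-exclusion over the monochromatic edges gives Stanley's expansion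
  \<open>X\<^sub>T = \<Sum>F\<subseteq>E. (-1)\<^bsup>|F|\<^esup> p\<^bsub>type F\<^esub>\<close>, where \<open>type F\<close> is the partition of \<open>n\<close> into the component
  sizes of \<open>(V, F)\<close>; its length is \<open>n - |F|\<close> because \<open>T\<close> is a tree. Since the power sums are linearly
  independent, \<open>\<Sum>\<^sub>\<lambda> g(\<lambda>) c\<^sub>\<lambda>(T) = \<Sum>\<^sub>F (-1)\<^bsup>|F|\<^esup> g(type F)\<close> for every function \<open>g\<close>.

  For \<open>\<lambda> = type F\<close> the first binomial coefficient of \<open>\<psi>\<close> counts the edge sets \<open>B \<supseteq> F\<close> with \<open>a + b\<close>
  elements, and the sum over the parts counts the \<open>a\<close>-element sets \<open>A\<close> lying in one component of \<open>F\<close>,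
  that is, those with \<open>A \<union> K(A) \<subseteq> F\<close>. In the triple sum over \<open>A \<union> K(A) \<subseteq> F \<subseteq> B\<close> the signs cancel
  unless \<open>A \<union> K(A) = B\<close>, which leaves the number of \<open>A\<close> with \<open>|A| = a\<close> and \<open>|K(A)| = b\<close>.

  For a subtree \<open>S\<close>, \<open>A \<union> K(A) = S\<close> holds iff \<open>L(S) \<subseteq> A \<subseteq> S\<close>. So the coefficients of \<open>K\<^sub>T\<close> are binomial
  sums of those of \<open>S\<^sub>T\<close>, and \<open>\<phi>\<close> arises by binomial inversion.
\<close>

section \<open>Sign cancellation over an interval of sets\<close>

text \<open>Toggling a fixed \<open>e\<close> in \<open>B - X\<close> is an involution of the
  interval that flips the parity of \<open>card F\<close>, so the sum equals its own
  negative.\<close>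

lemma sum_minus_one_card_interval:
  assumes "finite B" "X \<subset> B"
  shows "(\<Sum>F | X \<subseteq> F \<and> F \<subseteq> B. (-1) ^ card F) = (0 :: rat)"
proof -
  obtain e where e: "e \<in> B" "e \<notin> X" using assms(2) by blast
  define t where "t F = (if e \<in> F then F - {e} else insert e F)" for F
  let ?I = "{F. X \<subseteq> F \<and> F \<subseteq> B}"
  have sgn: "(-1) ^ card (t F) = - ((-1) ^ card F :: rat)" if "F \<subseteq> B" for F
  proof -
    have f: "finite F" using that assms(1) by (rule finite_subset)
    show ?thesis
    proof (cases "e \<in> F")
      case True
      then have "card F = Suc (card (F - {e}))"
        using f by (metis card_Suc_Diff1)
      then have "(-1) ^ card F = - ((-1) ^ card (F - {e}) :: rat)"
        by (simp del: card_Diff_singleton card_Diff_insert)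
      with True show ?thesis by (simp add: t_def del: card_Diff_singleton card_Diff_insert)
    qed (use f in \<open>simp add: t_def\<close>)
  qed
  have "(\<Sum>F\<in>?I. (-1) ^ card F) = (\<Sum>F\<in>?I. (-1) ^ card (t F) :: rat)"
    by (rule sum.reindex_bij_witness[where i = t and j = t]) (use e in \<open>auto simp: t_def insert_absorb simp del: card_Diff_singleton card_Diff_insert\<close>)
  also have "\<dots> = - (\<Sum>F\<in>?I. (-1) ^ card F)"
    unfolding sum_negf[symmetric] by (rule sum.cong) (auto simp: sgn)
  finally show ?thesis by simp
qed

section \<open>Products of power sums\<close>

lemma ps_coeff_monomial_sum: "ps_coeff (monomial_sum I u) m = of_nat (card {i \<in> I. u i = m})"
  by (simp add: monomial_sum_def Abs_power_series_inverse)

lemma ps_coeff_0 [simp]: "ps_coeff 0 m = 0"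
  by transfer simp

lemma ps_coeff_add [simp]: "ps_coeff (f + g) m = ps_coeff f m + ps_coeff g m"
  by transfer simp

lemma ps_coeff_sum [simp]: "ps_coeff (\<Sum>i\<in>I. f i) m = (\<Sum>i\<in>I. ps_coeff (f i) m)"
  by (induction I rule: infinite_finite_induct) auto

lemma ps_coeff_scale [simp]: "ps_coeff (ps_scale c f) m = c * ps_coeff f m"
  by transfer simp

lemma ps_coeff_mult: "ps_coeff (f * g) m = (\<Sum>(a, b) | a + b = m. ps_coeff f a * ps_coeff g b)"
  by (simp add: times_power_series.rep_eq)

text \<open>The condition under which \<open>monomial_sum\<close> is a genuine formal sum: an
  infinite fibre has \<open>card\<close> 0, so it would be counted as absent.\<close>

definition finite_fibres :: "'i set \<Rightarrow> ('i \<Rightarrow> monomial) \<Rightarrow> bool"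
  where "finite_fibres I u \<longleftrightarrow> (\<forall>m. finite {i \<in> I. u i = m})"

lemma fibre_Times:
  "{p \<in> I \<times> J. (case p of (i, j) \<Rightarrow> u i + v j) = m} =
    (\<Union>(a, b) \<in> {(a, b). a + b = m}. {i \<in> I. u i = a} \<times> {j \<in> J. v j = b})"
  by auto

lemma finite_fibres_Times:
  assumes "finite_fibres I u" "finite_fibres J v"
  shows "finite_fibres (I \<times> J) (\<lambda>(i, j). u i + v j)"
  unfolding finite_fibres_def fibre_Times
  using assms finite_monomial_splittings by (auto simp: finite_fibres_def)

text \<open>The fibre over \<open>m\<close> in the product is the disjoint union, over the finitely
  many splittings \<open>a + b = m\<close>, of products of fibres.\<close>

lemma monomial_sum_times:
  assumes "finite_fibres I u" "finite_fibres J v"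
  shows "monomial_sum I u * monomial_sum J v = monomial_sum (I \<times> J) (\<lambda>(i, j). u i + v j)"
proof (rule power_series_eqI)
  fix m
  let ?P = "{(a, b :: monomial). a + b = m}"
  have "card {p \<in> I \<times> J. (case p of (i, j) \<Rightarrow> u i + v j) = m} =
      (\<Sum>q\<in>?P. card (case q of (a, b) \<Rightarrow> {i \<in> I. u i = a} \<times> {j \<in> J. v j = b}))"
    unfolding fibre_Times
    by (rule card_UN_disjoint)
      (use assms finite_monomial_splittings in \<open>auto simp: finite_fibres_def\<close>)
  then show "ps_coeff (monomial_sum I u * monomial_sum J v) m =
      ps_coeff (monomial_sum (I \<times> J) (\<lambda>(i, j). u i + v j)) m"
    by (simp add: ps_coeff_mult ps_coeff_monomial_sum card_cartesian_product split_beta)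
qed

lemma bij_betw_fibre:
  assumes "bij_betw h I J" "\<And>i. i \<in> I \<Longrightarrow> v (h i) = u i"
  shows "bij_betw h {i \<in> I. u i = m} {j \<in> J. v j = m}"
proof (rule bij_betw_subset[OF assms(1)])
  show "h ` {i \<in> I. u i = m} = {j \<in> J. v j = m}"
    using assms by (force simp: bij_betw_def)
qed auto

lemma monomial_sum_reindex:
  assumes "bij_betw h I J" "\<And>i. i \<in> I \<Longrightarrow> v (h i) = u i"
  shows "monomial_sum I u = monomial_sum J v"
  by (intro power_series_eqI)
    (simp add: ps_coeff_monomial_sum
      bij_betw_same_card[OF bij_betw_fibre[where h = h and u = u and v = v, OF assms]])

lemma finite_fibres_reindex:
  assumes "bij_betw h I J" "\<And>i. i \<in> I \<Longrightarrow> v (h i) = u i" "finite_fibres I u"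
  shows "finite_fibres J v"
  using bij_betw_finite[OF bij_betw_fibre[where h = h and u = u and v = v, OF assms(1,2)]] assms(3)
  by (simp add: finite_fibres_def)

lemma bij_betw_PiE_insert:
  assumes "x \<notin> C"
  shows "bij_betw (\<lambda>(y, f). f(x := y)) (I \<times> (C \<rightarrow>\<^sub>E I)) (insert x C \<rightarrow>\<^sub>E I)"
  unfolding bij_betw_def PiE_insert_eq
  by (auto intro!: inj_combinator[OF assms])

text \<open>A product of formal sums expands by choosing one term from every factor. The two claims
  share one induction because the product rule needs finite fibres for the partial product.\<close>

lemma prod_monomial_sum_aux:
  assumes "finite C" "\<And>c. c \<in> C \<Longrightarrow> finite_fibres I (u c)"
  shows "(\<Prod>c\<in>C. monomial_sum I (u c)) =
      monomial_sum (C \<rightarrow>\<^sub>E I) (\<lambda>f. \<Sum>c\<in>C. u c (f c)) \<and>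
    finite_fibres (C \<rightarrow>\<^sub>E I) (\<lambda>f. \<Sum>c\<in>C. u c (f c))"
  using assms
proof (induction C rule: finite_induct)
  case empty
  have "1 = monomial_sum ({} \<rightarrow>\<^sub>E I) (\<lambda>f. \<Sum>c\<in>{}. u c (f c))"
    by (rule power_series_eqI) (simp add: ps_coeff_monomial_sum one_power_series.rep_eq)
  then show ?case by (simp add: finite_fibres_def)
next
  case (insert x C)
  let ?v = "\<lambda>C f. \<Sum>c\<in>C. u c (f c)"
  let ?w = "\<lambda>(y, f). u x y + ?v C f"
  have bij: "bij_betw (\<lambda>(y, f). f(x := y)) (I \<times> (C \<rightarrow>\<^sub>E I)) (insert x C \<rightarrow>\<^sub>E I)"
    using insert by (intro bij_betw_PiE_insert)
  have w: "?v (insert x C) ((\<lambda>(y, f). f(x := y)) p) = ?w p" for p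
  proof -
    obtain y f where p: "p = (y, f)" by (cases p)
    have "(\<Sum>c\<in>C. u c ((f(x := y)) c)) = (\<Sum>c\<in>C. u c (f c))"
      by (rule sum.cong) (use insert.hyps in auto)
    then show ?thesis using insert.hyps by (simp add: p)
  qed
  have IH: "(\<Prod>c\<in>C. monomial_sum I (u c)) = monomial_sum (C \<rightarrow>\<^sub>E I) (?v C)"
    "finite_fibres (C \<rightarrow>\<^sub>E I) (?v C)"
    using insert by auto
  have ux: "finite_fibres I (u x)" using insert.prems by simp
  have "(\<Prod>c\<in>insert x C. monomial_sum I (u c)) = monomial_sum (I \<times> (C \<rightarrow>\<^sub>E I)) ?w"
    using insert.hyps IH by (simp add: monomial_sum_times[OF ux IH(2)])
  also have "\<dots> = monomial_sum (insert x C \<rightarrow>\<^sub>E I) (?v (insert x C))"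
    by (rule monomial_sum_reindex[where u = ?w and v = "?v (insert x C)", OF bij w])
  finally show ?case
    using finite_fibres_reindex[where u = ?w and v = "?v (insert x C)", OF bij w finite_fibres_Times[OF ux IH(2)]] by blast
qed

lemmas prod_monomial_sum = prod_monomial_sum_aux[THEN conjunct1]
lemmas finite_fibres_PiE = prod_monomial_sum_aux[THEN conjunct2]

text \<open>For positive \<open>k\<close> the exponent vector determines \<open>i\<close>; for
  \<open>k = 0\<close> all of them would be the zero vector.\<close>

lemma finite_fibres_single:
  assumes "k > 0"
  shows "finite_fibres I (\<lambda>i. Poly_Mapping.single i k)"
  unfolding finite_fibres_def
proof
  fix m
  have "inj_on (\<lambda>i. Poly_Mapping.single i k) {i \<in> I. Poly_Mapping.single i k = m}"
    using assms by (auto simp: inj_on_def dest: arg_cong[where f = Poly_Mapping.keys])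
  moreover have "finite ((\<lambda>i. Poly_Mapping.single i k) ` {i \<in> I. Poly_Mapping.single i k = m})"
    by (rule finite_subset[of _ "{m}"]) auto
  ultimately show "finite {i \<in> I. Poly_Mapping.single i k = m}"
    by (rule finite_imageD[rotated])
qed

section \<open>Linear independence of the power sums\<close>

text \<open>Nothing cancels in a product of power sums, so a single positive summand already makes a
  coefficient positive.\<close>

lemma ps_coeff_power_sum_partition_nonneg: "ps_coeff (power_sum_partition lam) m \<ge> 0"
proof (induction lam arbitrary: m)
  case empty
  then show ?case by (simp add: power_sum_partition_def one_power_series.rep_eq)
next
  case (add k lam)
  then show ?case
    by (auto simp: power_sum_partition_def power_sum_def ps_coeff_mult ps_coeff_monomial_sum
        intro!: sum_nonneg mult_nonneg_nonneg)
qed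

text \<open>The partition read off from a monomial by forgetting which variables carry the
  exponents.\<close>

definition exponents :: "monomial \<Rightarrow> nat multiset"
  where "exponents m = image_mset (Poly_Mapping.lookup m) (mset_set (Poly_Mapping.keys m))"

lemma exponents_single_plus:
  assumes "i \<notin> Poly_Mapping.keys b" "k > 0"
  shows "exponents (Poly_Mapping.single i k + b) = add_mset k (exponents b)"
    and "card (Poly_Mapping.keys (Poly_Mapping.single i k + b)) = Suc (card (Poly_Mapping.keys b))"
proof -
  have keys: "Poly_Mapping.keys (Poly_Mapping.single i k + b) = insert i (Poly_Mapping.keys b)"
    using assms by (auto simp: in_keys_iff lookup_add lookup_single when_def split: if_splits)
  then show "card (Poly_Mapping.keys (Poly_Mapping.single i k + b)) = Suc (card (Poly_Mapping.keys b))"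
    using assms by simp
  have "image_mset (Poly_Mapping.lookup (Poly_Mapping.single i k + b)) (mset_set (Poly_Mapping.keys b))
      = exponents b"
    unfolding exponents_def
    by (rule image_mset_cong) (use assms in \<open>auto simp: lookup_add lookup_single when_def\<close>)
  then show "exponents (Poly_Mapping.single i k + b) = add_mset k (exponents b)"
    using assms by (simp add: exponents_def keys lookup_add in_keys_iff)
qed

text \<open>Expanding the product assigns a variable to each part, and parts with the same variable
  merge into one exponent. Hence at most \<open>size lam\<close> variables occur, and with equality
  nothing has merged.\<close>

lemma power_sum_partition_support:
  assumes "ps_coeff (power_sum_partition lam) m \<noteq> 0" "0 \<notin># lam"
  shows "card (Poly_Mapping.keys m) \<le> size lam \<and>
    (card (Poly_Mapping.keys m) = size lam \<longrightarrow> exponents m = lam)"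
  using assms
proof (induction lam arbitrary: m)
  case empty
  then show ?case
    by (auto simp: power_sum_partition_def one_power_series.rep_eq exponents_def split: if_splits)
next
  case (add k lam)
  have k: "k > 0" using add.prems by auto
  have "(\<Sum>(a, b) | a + b = m. ps_coeff (power_sum k) a * ps_coeff (power_sum_partition lam) b) \<noteq> 0"
    using add.prems(1) by (simp add: power_sum_partition_def ps_coeff_mult)
  then obtain a b where ab: "a + b = m" "ps_coeff (power_sum k) a \<noteq> 0"
    "ps_coeff (power_sum_partition lam) b \<noteq> 0"
    by (auto elim!: sum.not_neutral_contains_not_neutral)
  then obtain i where a: "a = Poly_Mapping.single i k"
    by (auto simp: power_sum_def ps_coeff_monomial_sum card_eq_0_iff)
  have IH: "card (Poly_Mapping.keys b) \<le> size lam"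
    "card (Poly_Mapping.keys b) = size lam \<Longrightarrow> exponents b = lam"
    using add.IH[OF ab(3)] add.prems by auto
  show ?case
  proof (cases "i \<in> Poly_Mapping.keys b")
    case True
    have "Poly_Mapping.keys m \<subseteq> Poly_Mapping.keys a \<union> Poly_Mapping.keys b"
      unfolding ab(1)[symmetric] by (rule keys_add)
    also have "\<dots> \<subseteq> Poly_Mapping.keys b" using True a k by simp
    finally have "card (Poly_Mapping.keys m) \<le> card (Poly_Mapping.keys b)"
      by (intro card_mono) auto
    with IH show ?thesis by simp
  next
    case False
    from exponents_single_plus[OF this k] IH show ?thesis
      by (auto simp: a ab(1)[symmetric])
  qed
qed

text \<open>Giving every part a fresh variable produces a monomial with as many variables as
  parts.\<close>

lemma power_sum_partition_leading_monomial:
  assumes "0 \<notin># lam"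
  shows "\<exists>m. ps_coeff (power_sum_partition lam) m > 0 \<and> card (Poly_Mapping.keys m) = size lam"
  using assms
proof (induction lam)
  case empty
  then show ?case
    by (intro exI[of _ 0]) (simp add: power_sum_partition_def one_power_series.rep_eq)
next
  case (add k lam)
  then obtain b where b: "ps_coeff (power_sum_partition lam) b > 0"
    "card (Poly_Mapping.keys b) = size lam" by auto
  have k: "k > 0" using add.prems by auto
  \<comment> \<open>The index 0 is excluded along with the used variables, because
    \<open>power_sum\<close> sums over \<open>{1..}\<close> only.\<close>
  obtain i where i: "i \<notin> insert 0 (Poly_Mapping.keys b)"
    using ex_new_if_finite[of "insert 0 (Poly_Mapping.keys b)"] by auto
  let ?a = "Poly_Mapping.single i k"
  let ?f = "\<lambda>(a, b). ps_coeff (power_sum k) a * ps_coeff (power_sum_partition lam) b"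
  have "finite {j \<in> {1..}. Poly_Mapping.single j k = ?a}"
    using finite_fibres_single[OF k, of "{1..}"] by (simp only: finite_fibres_def)
  then have "ps_coeff (power_sum k) ?a > 0"
    using i by (auto simp: power_sum_def ps_coeff_monomial_sum card_gt_0_iff intro!: exI[of _ i])
  then have "0 < ?f (?a, b)" using b by simp
  also have "\<dots> \<le> sum ?f {(a, b'). a + b' = ?a + b}"
    by (rule member_le_sum)
      (auto simp: finite_monomial_splittings ps_coeff_power_sum_partition_nonneg
        power_sum_def ps_coeff_monomial_sum)
  finally have "ps_coeff (power_sum_partition (add_mset k lam)) (?a + b) > 0"
    by (simp add: power_sum_partition_def ps_coeff_mult)
  then show ?case
    using exponents_single_plus(2)[of i b k] i k b by (intro exI[of _ "?a + b"]) simp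
qed

text \<open>Among the partitions with nonzero coefficient take a longest one: the monomial with its parts
  as exponents occurs in no other power sum of the combination.\<close>

lemma power_sum_partition_independent:
  assumes "(\<Sum>lam\<in>partitions n. ps_scale (c lam) (power_sum_partition lam)) = 0"
    and "mu \<in> partitions n"
  shows "c mu = 0"
proof (rule ccontr)
  assume mu: "c mu \<noteq> 0"
  let ?S = "{lam \<in> partitions n. c lam \<noteq> 0}"
  have fin: "finite ?S" using finite_partitions by simp
  have "Max (size ` ?S) \<in> size ` ?S"
    by (rule Max_in) (use fin mu assms(2) in auto)
  then obtain nu where nu: "nu \<in> ?S" "size nu = Max (size ` ?S)" by auto
  have max: "size lam \<le> size nu" if "lam \<in> ?S" for lam
    using that fin nu(2) by simp
  have pos: "0 \<notin># lam" if "lam \<in> partitions n" for lam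
    using that by (simp add: partitions_def)
  obtain m where m: "ps_coeff (power_sum_partition nu) m > 0" "card (Poly_Mapping.keys m) = size nu"
    using power_sum_partition_leading_monomial pos nu(1) by blast
  have other: "c lam * ps_coeff (power_sum_partition lam) m = 0"
    if "lam \<in> partitions n" "lam \<noteq> nu" for lam
  proof (rule ccontr)
    assume *: "c lam * ps_coeff (power_sum_partition lam) m \<noteq> 0"
    then have "size lam \<le> size nu" using max that by auto
    moreover have "exponents m = nu"
      using power_sum_partition_support[of nu m] m pos nu(1) by auto
    ultimately show False
      using power_sum_partition_support[of lam m] * pos[OF that(1)] that(2) m(2) by auto
  qed
  have "0 = (\<Sum>lam\<in>partitions n. c lam * ps_coeff (power_sum_partition lam) m)"
    using arg_cong[OF assms(1), of "\<lambda>f. ps_coeff f m"] by simp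
  also have "\<dots> = (\<Sum>lam\<in>{nu}. c lam * ps_coeff (power_sum_partition lam) m)"
    by (rule sum.mono_neutral_right) (use finite_partitions nu(1) other in auto)
  finally show False using m(1) nu(1) by simp
qed

text \<open>Resolves the definite description: independence fixes the values on
  \<open>partitions n\<close>, and the vanishing condition fixes them elsewhere.\<close>

lemma power_sum_coeff_eqI:
  assumes "\<And>lam. lam \<notin> partitions n \<Longrightarrow> c lam = 0"
    and "f = (\<Sum>lam\<in>partitions n. ps_scale (c lam) (power_sum_partition lam))"
  shows "power_sum_coeff n f = c"
  unfolding power_sum_coeff_def
proof (rule the_equality)
  fix c'
  assume c': "(\<forall>lam. lam \<notin> partitions n \<longrightarrow> c' lam = 0) \<and>
    f = (\<Sum>lam\<in>partitions n. ps_scale (c' lam) (power_sum_partition lam))"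
  have "(\<Sum>lam\<in>partitions n. ps_scale (c' lam - c lam) (power_sum_partition lam)) = 0"
  proof (rule power_series_eqI)
    fix m
    have "ps_coeff (\<Sum>lam\<in>partitions n. ps_scale (c' lam) (power_sum_partition lam)) m =
        ps_coeff (\<Sum>lam\<in>partitions n. ps_scale (c lam) (power_sum_partition lam)) m"
      using c' assms(2) by simp
    then show "ps_coeff (\<Sum>lam\<in>partitions n. ps_scale (c' lam - c lam) (power_sum_partition lam)) m =
        ps_coeff 0 m"
      by (simp add: left_diff_distrib sum_subtractf)
  qed
  from power_sum_partition_independent[OF this] have "c' lam = c lam" if "lam \<in> partitions n" for lam
    using that by simp
  with c' assms(1) show "c' = c" by (metis ext)
qed (use assms in blast)

section \<open>Components\<close>

definition adj :: "'a set set \<Rightarrow> ('a \<times> 'a) set"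
  where "adj F = {(x, y). {x, y} \<in> F}"

text \<open>This depends on the edge set alone. A point on no edge of \<open>F\<close> is its own
  component, so isolated vertices enter only through \<open>V\<close> in
  \<open>components\<close>.\<close>

definition component :: "'a set set \<Rightarrow> 'a \<Rightarrow> 'a set"
  where "component F u = (adj F)\<^sup>* `` {u}"

definition components :: "'a set \<Rightarrow> 'a set set \<Rightarrow> 'a set set"
  where "components V F = component F ` V"

definition component_type :: "'a set \<Rightarrow> 'a set set \<Rightarrow> nat multiset"
  where "component_type V F = image_mset card (mset_set (components V F))"

lemma connected_graph_iff: "connected_graph V E \<longleftrightarrow> V \<noteq> {} \<and> (\<forall>u\<in>V. \<forall>v\<in>V. (u, v) \<in> (adj E)\<^sup>*)"
  by (simp add: connected_graph_def adj_def)

lemma sym_adj: "sym (adj F)"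
  by (auto simp: sym_def adj_def insert_commute)

lemma adj_rtrancl_sym: "(x, y) \<in> (adj F)\<^sup>* \<Longrightarrow> (y, x) \<in> (adj F)\<^sup>*"
  using sym_rtrancl[OF sym_adj] by (rule symD)

lemma adj_rtrancl_mono: "F \<subseteq> G \<Longrightarrow> (x, y) \<in> (adj F)\<^sup>* \<Longrightarrow> (x, y) \<in> (adj G)\<^sup>*"
  by (rule subsetD[OF rtrancl_mono]) (auto simp: adj_def)

lemma mem_component: "y \<in> component F x \<longleftrightarrow> (x, y) \<in> (adj F)\<^sup>*"
  by (simp add: component_def)

lemma component_self [simp]: "x \<in> component F x"
  by (simp add: mem_component)

lemma component_nonempty [simp]: "component F x \<noteq> {}"
  by (auto simp: component_def)

lemma component_eq_iff: "component F x = component F y \<longleftrightarrow> (x, y) \<in> (adj F)\<^sup>*"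
  unfolding set_eq_iff mem_component
  by (meson adj_rtrancl_sym rtrancl.rtrancl_refl rtrancl_trans)

lemma component_subset:
  assumes "\<Union>F \<subseteq> V" "x \<in> V"
  shows "component F x \<subseteq> V"
proof
  fix y assume "y \<in> component F x"
  then have "(x, y) \<in> (adj F)\<^sup>*" by (simp add: mem_component)
  then show "y \<in> V"
    by (induction rule: rtrancl_induct) (use assms in \<open>auto simp: adj_def\<close>)
qed

lemma components_disjoint:
  assumes "C \<in> components V F" "D \<in> components V F" "x \<in> C" "x \<in> D"
  shows "C = D"
  using assms by (auto simp: components_def mem_component component_eq_iff[symmetric])

lemma components_pairwise_disjoint: "pairwise disjnt (components V F)"
  unfolding pairwise_def disjnt_def using components_disjoint[of _ V F] by (metis disjoint_iff)

lemma Union_components: "\<Union>F \<subseteq> V \<Longrightarrow> \<Union>(components V F) = V"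
  unfolding components_def
proof
  assume F: "\<Union>F \<subseteq> V"
  show "\<Union>(component F ` V) \<subseteq> V" using component_subset[OF F] by blast
  show "V \<subseteq> \<Union>(component F ` V)" using component_self by fast
qed

lemma component_type_partition:
  assumes "finite V" "\<Union>F \<subseteq> V"
  shows "component_type V F \<in> partitions (card V)"
proof -
  have fin: "finite (components V F)" using assms(1) by (simp add: components_def)
  have sub: "C \<subseteq> V" "C \<noteq> {}" if "C \<in> components V F" for C
    using that component_subset[OF assms(2)] component_self by (auto simp: components_def)
  have "card V = (\<Sum>C\<in>components V F. card C)"
    using card_Union_disjoint[of "components V F"] finite_subset[OF sub(1) assms(1)]
    by (metis Union_components assms(2) components_pairwise_disjoint)
  moreover have "0 \<notin># component_type V F"
    using sub fin finite_subset[OF sub(1) assms(1)] by (auto simp: component_type_def)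
  ultimately show ?thesis
    by (simp add: partitions_def component_type_def sum_unfold_sum_mset)
qed

lemma constant_on_component:
  assumes "\<And>x y. {x, y} \<in> F \<Longrightarrow> \<kappa> x = \<kappa> y" "(x, y) \<in> (adj F)\<^sup>*"
  shows "\<kappa> x = \<kappa> y"
  using assms(2) by (induction rule: rtrancl_induct) (use assms(1) in \<open>auto simp: adj_def\<close>)

section \<open>Stanley's power sum expansion\<close>

abbreviation coloring_monomial :: "'a set \<Rightarrow> ('a \<Rightarrow> nat) \<Rightarrow> monomial"
  where "coloring_monomial V \<kappa> \<equiv> \<Sum>v\<in>V. Poly_Mapping.single (\<kappa> v) 1"

lemma sum_single_one: "(\<Sum>v\<in>C. Poly_Mapping.single i (1 :: nat)) = Poly_Mapping.single i (card C)"
  by (induction C rule: infinite_finite_induct) (auto simp: single_add[symmetric] simp del: sum_constant)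

text \<open>A coloring that makes every edge of \<open>F\<close> monochromatic is a free choice of
  one color per component, and a component \<open>C\<close> of color \<open>i\<close> contributes
  the \<open>card C\<close>-th power of the variable with index \<open>i\<close>.\<close>

lemma power_sum_component_type:
  assumes "finite V" "\<Union>F \<subseteq> V"
  shows "power_sum_partition (component_type V F) =
    monomial_sum {\<kappa> \<in> V \<rightarrow>\<^sub>E {1..}. \<forall>x y. {x, y} \<in> F \<longrightarrow> \<kappa> x = \<kappa> y} (coloring_monomial V)"
proof -
  let ?C = "components V F"
  let ?u = "\<lambda>f. \<Sum>C\<in>?C. Poly_Mapping.single (f C) (card C)"
  let ?K = "{\<kappa> \<in> V \<rightarrow>\<^sub>E {1 :: nat..}. \<forall>x y. {x, y} \<in> F \<longrightarrow> \<kappa> x = \<kappa> y}"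
  \<comment> \<open>\<open>h\<close> spreads the color of a component over its vertices and
    \<open>g\<close> reads it off at an arbitrary representative. Both are restricted functions, as
    the extensional function spaces require.\<close>
  define h :: "('a set \<Rightarrow> nat) \<Rightarrow> 'a \<Rightarrow> nat" where "h f = (\<lambda>v\<in>V. f (component F v))" for f
  define g :: "('a \<Rightarrow> nat) \<Rightarrow> 'a set \<Rightarrow> nat" where "g \<kappa> = (\<lambda>C\<in>?C. \<kappa> (SOME v. v \<in> C))" for \<kappa>
  have fin: "finite ?C" using assms(1) by (simp add: components_def)
  have sub: "C \<subseteq> V" "C \<noteq> {}" if "C \<in> ?C" for C
    using that component_subset[OF assms(2)] component_self by (auto simp: components_def)
  have some: "(SOME v. v \<in> C) \<in> C" if "C \<in> ?C" for C
    using sub(2)[OF that] by (simp add: some_in_eq)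
  have comp_eq: "component F v = C" if "C \<in> ?C" "v \<in> C" for C v
    using that by (auto simp: components_def mem_component component_eq_iff[symmetric])
  have pos: "card C > 0" if "C \<in> ?C" for C
    using sub[OF that] finite_subset[OF sub(1)[OF that] assms(1)] by (simp add: card_gt_0_iff)
  have "power_sum_partition (component_type V F) = (\<Prod>C\<in>?C. power_sum (card C))"
    by (simp add: power_sum_partition_def component_type_def prod_unfold_prod_mset
        image_mset.compositionality comp_def)
  also have "\<dots> = monomial_sum (?C \<rightarrow>\<^sub>E {1..}) ?u"
    unfolding power_sum_def
    by (rule prod_monomial_sum[OF fin]) (use pos finite_fibres_single in blast)
  also have "\<dots> = monomial_sum ?K (coloring_monomial V)"
  proof (rule monomial_sum_reindex)
    show "bij_betw h (?C \<rightarrow>\<^sub>E {1..}) ?K"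
    proof (rule bij_betw_byWitness[where f' = g])
      show "\<forall>f\<in>?C \<rightarrow>\<^sub>E {1..}. g (h f) = f"
      proof
        fix f :: "'a set \<Rightarrow> nat" assume f: "f \<in> ?C \<rightarrow>\<^sub>E {1..}"
        show "g (h f) = f"
        proof
          fix C
          show "g (h f) C = f C"
          proof (cases "C \<in> ?C")
            case True
            then have "(SOME v. v \<in> C) \<in> V" using some sub by blast
            then show ?thesis using True comp_eq[OF True some[OF True]] by (simp add: g_def h_def)
          qed (use f in \<open>auto simp: g_def\<close>)
        qed
      qed
      show "\<forall>\<kappa>\<in>?K. h (g \<kappa>) = \<kappa>"
      proof
        fix \<kappa> assume k: "\<kappa> \<in> ?K"
        show "h (g \<kappa>) = \<kappa>"
        proof
          fix v
          show "h (g \<kappa>) v = \<kappa> v"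
          proof (cases "v \<in> V")
            case True
            then have C: "component F v \<in> ?C" by (simp add: components_def)
            have "(v, SOME w. w \<in> component F v) \<in> (adj F)\<^sup>*"
              using some[OF C] by (simp add: mem_component)
            then have "\<kappa> v = \<kappa> (SOME w. w \<in> component F v)"
              using k constant_on_component[of F \<kappa>] by blast
            then show ?thesis using True C by (simp add: h_def g_def)
          qed (use k in \<open>auto simp: h_def\<close>)
        qed
      qed
      show "h ` (?C \<rightarrow>\<^sub>E {1..}) \<subseteq> ?K"
      proof
        fix \<kappa> assume "\<kappa> \<in> h ` (?C \<rightarrow>\<^sub>E {1..})"
        then obtain f where f: "f \<in> ?C \<rightarrow>\<^sub>E {1..}" "\<kappa> = h f" by blast
        have "h f \<in> V \<rightarrow>\<^sub>E {1..}"
          using f(1) by (auto simp: h_def components_def)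
        moreover have "h f x = h f y" if "{x, y} \<in> F" for x y
        proof -
          have "component F x = component F y"
            unfolding component_eq_iff using that by (auto simp: adj_def)
          moreover have "x \<in> V" "y \<in> V" using that assms(2) by auto
          ultimately show ?thesis by (simp add: h_def)
        qed
        ultimately show "\<kappa> \<in> ?K" using f(2) by blast
      qed
      show "g ` ?K \<subseteq> ?C \<rightarrow>\<^sub>E {1..}"
        using some sub by (fastforce simp: g_def)
    qed
    fix f :: "'a set \<Rightarrow> nat" assume f: "f \<in> ?C \<rightarrow>\<^sub>E {1..}"
    \<comment> \<open>The vertex sum splits over the disjoint components, and \<open>h f\<close> is
      constant on each of them.\<close>
    have "coloring_monomial V (h f) = (\<Sum>C\<in>?C. \<Sum>v\<in>C. Poly_Mapping.single (h f v) 1)"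
    proof -
      have "\<forall>C\<in>?C. \<forall>D\<in>?C. C \<noteq> D \<longrightarrow> C \<inter> D = {}"
        using components_pairwise_disjoint[of V F] by (simp add: pairwise_def disjnt_def)
      moreover have "\<forall>C\<in>?C. finite C" using finite_subset[OF sub(1) assms(1)] by blast
      ultimately show ?thesis
        using sum.Union_disjoint[of ?C "\<lambda>v. Poly_Mapping.single (h f v) (1 :: nat)"]
        by (simp only: Union_components[OF assms(2)] comp_apply simp_thms)
    qed
    also have "\<dots> = ?u f"
    proof (rule sum.cong[OF refl])
      fix C assume C: "C \<in> ?C"
      have "(\<Sum>v\<in>C. Poly_Mapping.single (h f v) 1) = (\<Sum>v\<in>C. Poly_Mapping.single (f C) (1::nat))"
        using sub(1)[OF C] by (intro sum.cong) (auto simp: h_def comp_eq[OF C])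
      also have "\<dots> = Poly_Mapping.single (f C) (card C)"
        by (rule sum_single_one)
      finally show "(\<Sum>v\<in>C. Poly_Mapping.single (h f v) 1) = Poly_Mapping.single (f C) (card C)" .
    qed
    finally show "coloring_monomial V (h f) = ?u f" .
  qed
  finally show ?thesis .
qed

text \<open>The inclusion-exclusion is carried out one coefficient at a time: for fixed
  \<open>m\<close> only finitely many colorings count, so the sums over \<open>F\<close> and over
  colorings may be exchanged.\<close>

lemma chromatic_symmetric_function_expansion:
  assumes "simple_graph V E"
  shows "chromatic_symmetric_function V E =
    (\<Sum>F\<in>Pow E. ps_scale ((-1) ^ card F) (power_sum_partition (component_type V F)))"
proof (rule power_series_eqI)
  fix m
  have V: "finite V" and E: "\<Union>E \<subseteq> V" and two: "\<And>e. e \<in> E \<Longrightarrow> card e = 2"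
    using assms by (auto simp: simple_graph_def)
  have finE: "finite E" using V E by (meson finite_UnionD finite_subset)
  define K where "K = {\<kappa> \<in> V \<rightarrow>\<^sub>E {1..}. coloring_monomial V \<kappa> = m}"
  have finK: "finite K"
    using finite_fibres_PiE[OF V finite_fibres_single[of 1], of "{1..}"]
    by (auto simp: K_def finite_fibres_def)
  \<comment> \<open>The monochromatic edges: \<open>F \<subseteq> M \<kappa>\<close> says that all
    edges of \<open>F\<close> are monochromatic, and \<open>M \<kappa> = {}\<close> that
    \<open>\<kappa>\<close> is proper.\<close>
  define M where "M \<kappa> = {e \<in> E. \<forall>x y. e = {x, y} \<longrightarrow> \<kappa> x = \<kappa> y}" for \<kappa> :: "'a \<Rightarrow> nat"
  have finM: "finite (M \<kappa>)" for \<kappa> using finE by (simp add: M_def)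
  have "ps_coeff (\<Sum>F\<in>Pow E. ps_scale ((-1) ^ card F) (power_sum_partition (component_type V F))) m =
      (\<Sum>F\<in>Pow E. (-1) ^ card F * of_nat (card {\<kappa> \<in> K. F \<subseteq> M \<kappa>}))"
    unfolding ps_coeff_sum ps_coeff_scale
  proof (rule sum.cong[OF refl])
    fix F assume F: "F \<in> Pow E"
    then have FV: "\<Union>F \<subseteq> V" using E by blast
    have "{\<kappa> \<in> {\<kappa> \<in> V \<rightarrow>\<^sub>E {1..}. \<forall>x y. {x, y} \<in> F \<longrightarrow> \<kappa> x = \<kappa> y}. coloring_monomial V \<kappa> = m}
        = {\<kappa> \<in> K. F \<subseteq> M \<kappa>}"
      using F by (auto simp: K_def M_def)
    then show "(-1) ^ card F * ps_coeff (power_sum_partition (component_type V F)) m =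
        (-1) ^ card F * of_nat (card {\<kappa> \<in> K. F \<subseteq> M \<kappa>})"
      by (simp add: power_sum_component_type[OF V FV] ps_coeff_monomial_sum)
  qed
  also have "\<dots> = (\<Sum>F\<in>Pow E. \<Sum>\<kappa>\<in>K. if F \<subseteq> M \<kappa> then (-1) ^ card F else 0)"
    using finK by (simp add: sum.If_cases Int_def mult.commute)
  also have "\<dots> = (\<Sum>\<kappa>\<in>K. \<Sum>F\<in>Pow E. if F \<subseteq> M \<kappa> then (-1) ^ card F else 0)"
    by (rule sum.swap)
  also have "\<dots> = (\<Sum>\<kappa>\<in>K. if M \<kappa> = {} then 1 else 0)"
  proof (rule sum.cong[OF refl])
    fix \<kappa>
    have "(\<Sum>F\<in>Pow E. if F \<subseteq> M \<kappa> then (-1) ^ card F else (0::rat)) =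
        (\<Sum>F | {} \<subseteq> F \<and> F \<subseteq> M \<kappa>. (-1) ^ card F)"
      using finE by (intro sum.mono_neutral_cong_right) (auto simp: M_def)
    also have "\<dots> = (if M \<kappa> = {} then 1 else 0)"
    proof (cases "M \<kappa> = {}")
      case False
      then show ?thesis using sum_minus_one_card_interval[OF finM, of "{}" \<kappa>] by auto
    qed simp
    finally show "(\<Sum>F\<in>Pow E. if F \<subseteq> M \<kappa> then (-1) ^ card F else (0::rat)) =
        (if M \<kappa> = {} then 1 else 0)" .
  qed
  also have "\<dots> = of_nat (card {\<kappa> \<in> K. M \<kappa> = {}})"
    using finK by (simp add: sum.If_cases Int_def)
  also have "{\<kappa> \<in> K. M \<kappa> = {}} = {\<kappa> \<in> proper_colorings V E. coloring_monomial V \<kappa> = m}"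
  proof -
    have "M \<kappa> = {} \<longleftrightarrow> (\<forall>v\<in>V. \<forall>w\<in>V. {v, w} \<in> E \<longrightarrow> \<kappa> v \<noteq> \<kappa> w)" for \<kappa>
    proof
      assume "M \<kappa> = {}"
      then show "\<forall>v\<in>V. \<forall>w\<in>V. {v, w} \<in> E \<longrightarrow> \<kappa> v \<noteq> \<kappa> w"
        by (simp add: M_def) (metis doubleton_eq_iff)
    next
      assume proper: "\<forall>v\<in>V. \<forall>w\<in>V. {v, w} \<in> E \<longrightarrow> \<kappa> v \<noteq> \<kappa> w"
      show "M \<kappa> = {}"
      proof (rule ccontr)
        assume "M \<kappa> \<noteq> {}"
        then obtain e where e: "e \<in> E" "\<And>x y. e = {x, y} \<Longrightarrow> \<kappa> x = \<kappa> y" by (auto simp: M_def)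
        obtain x y where xy: "e = {x, y}" using two[OF e(1)] by (auto simp: card_2_iff)
        with e E proper show False by blast
      qed
    qed
    then show ?thesis by (auto simp: K_def proper_colorings_def)
  qed
  finally show "ps_coeff (chromatic_symmetric_function V E) m =
      ps_coeff (\<Sum>F\<in>Pow E. ps_scale ((-1) ^ card F) (power_sum_partition (component_type V F))) m"
    by (simp add: chromatic_symmetric_function_def ps_coeff_monomial_sum)
qed

text \<open>Collecting the edge sets of equal type in the expansion identifies the coefficient at
  \<open>lam\<close> as a signed count. Any weighting \<open>g\<close> of the coefficients thus
  becomes a signed sum over edge sets.\<close>

lemma sum_power_sum_coeff_chromatic:
  assumes "simple_graph V E" "card V = n"
  shows "(\<Sum>lam\<in>partitions n. g lam * power_sum_coeff n (chromatic_symmetric_function V E) lam) =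
    (\<Sum>F\<in>Pow E. (-1) ^ card F * g (component_type V F))"
proof -
  have V: "finite V" and E: "\<Union>E \<subseteq> V"
    using assms by (auto simp: simple_graph_def)
  have finE: "finite (Pow E)" using V E by (meson finite_Pow_iff finite_UnionD finite_subset)
  have type: "component_type V F \<in> partitions n" if "F \<in> Pow E" for F
    using component_type_partition[of V F] that V E assms(2) by auto
  define c where "c lam = (\<Sum>F | F \<in> Pow E \<and> component_type V F = lam. (-1 :: rat) ^ card F)" for lam
  have regroup: "(\<Sum>lam\<in>partitions n. \<Sum>F | F \<in> Pow E \<and> component_type V F = lam. f F) =
      (\<Sum>F\<in>Pow E. f F)" for f :: "'a set set \<Rightarrow> rat"
    by (rule sum.group) (use finE finite_partitions type in auto)
  have "power_sum_coeff n (chromatic_symmetric_function V E) = c"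
  proof (rule power_sum_coeff_eqI)
    fix lam assume "lam \<notin> partitions n"
    then have "{F. F \<in> Pow E \<and> component_type V F = lam} = {}" using type by auto
    then show "c lam = 0" unfolding c_def by (simp only: sum.empty)
  next
    show "chromatic_symmetric_function V E =
        (\<Sum>lam\<in>partitions n. ps_scale (c lam) (power_sum_partition lam))"
    proof (rule power_series_eqI)
      fix m
      let ?f = "\<lambda>F. (-1) ^ card F * ps_coeff (power_sum_partition (component_type V F)) m"
      have "ps_coeff (chromatic_symmetric_function V E) m = (\<Sum>F\<in>Pow E. ?f F)"
        by (simp add: chromatic_symmetric_function_expansion[OF assms(1)])
      also have "\<dots> = (\<Sum>lam\<in>partitions n. \<Sum>F | F \<in> Pow E \<and> component_type V F = lam. ?f F)"
        by (rule regroup[symmetric])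
      also have "\<dots> = (\<Sum>lam\<in>partitions n. c lam * ps_coeff (power_sum_partition lam) m)"
        by (simp add: c_def sum_distrib_right)
      finally show "ps_coeff (chromatic_symmetric_function V E) m =
          ps_coeff (\<Sum>lam\<in>partitions n. ps_scale (c lam) (power_sum_partition lam)) m"
        by simp
    qed
  qed
  then have "(\<Sum>lam\<in>partitions n. g lam * power_sum_coeff n (chromatic_symmetric_function V E) lam) =
      (\<Sum>lam\<in>partitions n. \<Sum>F | F \<in> Pow E \<and> component_type V F = lam.
        (-1) ^ card F * g (component_type V F))"
    by (simp add: c_def sum_distrib_left mult.commute)
  then show ?thesis by (simp only: regroup)
qed

section \<open>Trees\<close>

text \<open>A walk may cross the new edge repeatedly, but one crossing at most is needed: whenever
  it crosses again, its new position is already reachable with at most one crossing.\<close>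

lemma adj_rtrancl_insert_cases:
  assumes "(x, y) \<in> (adj (insert {u, v} F))\<^sup>*"
  shows "(x, y) \<in> (adj F)\<^sup>* \<or> ((x, u) \<in> (adj F)\<^sup>* \<and> (v, y) \<in> (adj F)\<^sup>*) \<or>
    ((x, v) \<in> (adj F)\<^sup>* \<and> (u, y) \<in> (adj F)\<^sup>*)"
  using assms
proof (induction rule: rtrancl_induct)
  case (step y z)
  from step.hyps(2) consider "(y, z) \<in> adj F" | "y = u" "z = v" | "y = v" "z = u"
    by (auto simp: adj_def doubleton_eq_iff)
  then show ?case
    using step.IH by cases (meson rtrancl.rtrancl_into_rtrancl rtrancl.rtrancl_refl)+
qed simp

text \<open>A step to a new vertex extends the path; a step to a visited vertex cuts the path back
  to that vertex. Distinctness is what \<open>graph_cycle\<close> asks for.\<close>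

lemma adj_rtrancl_distinct_path:
  assumes "(x, y) \<in> (adj F)\<^sup>*"
  shows "\<exists>vs. vs \<noteq> [] \<and> hd vs = x \<and> last vs = y \<and> distinct vs \<and>
    (\<forall>i. Suc i < length vs \<longrightarrow> {vs ! i, vs ! Suc i} \<in> F)"
  using assms
proof (induction rule: rtrancl_induct)
  case base
  show ?case by (rule exI[of _ "[x]"]) simp
next
  case (step y z)
  then obtain vs where vs: "vs \<noteq> []" "hd vs = x" "last vs = y" "distinct vs"
    "\<And>i. Suc i < length vs \<Longrightarrow> {vs ! i, vs ! Suc i} \<in> F" by blast
  show ?case
  proof (cases "z \<in> set vs")
    case True
    then obtain k where k: "k < length vs" "vs ! k = z" by (auto simp: in_set_conv_nth)
    let ?ws = "take (Suc k) vs"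
    have "hd ?ws = x" "distinct ?ws" "?ws \<noteq> []" using vs by (auto simp: hd_take)
    moreover have "last ?ws = z" using k by (simp add: take_Suc_conv_app_nth)
    moreover have "\<forall>i. Suc i < length ?ws \<longrightarrow> {?ws ! i, ?ws ! Suc i} \<in> F"
      using vs(5) by auto
    ultimately show ?thesis by blast
  next
    case False
    let ?ws = "vs @ [z]"
    have "{?ws ! i, ?ws ! Suc i} \<in> F" if "Suc i < length ?ws" for i
    proof (cases "Suc i < length vs")
      case True
      then show ?thesis using vs(5) by (simp add: nth_append)
    next
      case False
      then have i: "i = length vs - 1" "Suc i = length vs" using that vs(1) by auto
      have "vs ! i = y" using vs(1,3) i(1) by (simp add: last_conv_nth)
      then show ?thesis using i step.hyps(2) by (simp add: nth_append adj_def)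
    qed
    moreover have "hd ?ws = x" "distinct ?ws" "last ?ws = z" "?ws \<noteq> []" using vs False by auto
    ultimately show ?thesis by blast
  qed
qed

text \<open>A path from \<open>u\<close> to \<open>v\<close> that avoids the edge would be closed by
  it to a cycle.\<close>

lemma acyclic_edge_is_bridge:
  assumes "\<nexists>vs. graph_cycle E vs" "{u, v} \<in> E" "u \<noteq> v"
  shows "(u, v) \<notin> (adj (E - {{u, v}}))\<^sup>*"
proof
  assume "(u, v) \<in> (adj (E - {{u, v}}))\<^sup>*"
  from adj_rtrancl_distinct_path[OF this] obtain vs where
    vs: "vs \<noteq> []" "hd vs = u" "last vs = v" "distinct vs"
    "\<And>i. Suc i < length vs \<Longrightarrow> {vs ! i, vs ! Suc i} \<in> E - {{u, v}}" by blast
  have u: "vs ! 0 = u" using vs by (simp add: hd_conv_nth)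
  have v: "vs ! (length vs - 1) = v" using vs by (simp add: last_conv_nth)
  have "length vs \<noteq> 0" "length vs \<noteq> 1" using vs(1) u v assms(3) by auto
  \<comment> \<open>A path with two vertices would use the deleted edge itself.\<close>
  moreover have "length vs \<noteq> 2"
  proof
    assume "length vs = 2"
    then show False using vs(5)[of 0] u v by simp
  qed
  ultimately have len: "3 \<le> length vs" by linarith
  have "{vs ! i, vs ! (Suc i mod length vs)} \<in> E" if "i < length vs" for i
  proof (cases "Suc i < length vs")
    case True
    then show ?thesis using vs(5) by simp
  next
    case False
    \<comment> \<open>At the last index the successor wraps around to 0, which is the closing
      edge.\<close>
    then have "Suc i = length vs" using that by simp
    then have "i = length vs - 1" "Suc i mod length vs = 0" by auto
    then have "vs ! i = v" "Suc i mod length vs = 0" using v by auto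
    then show ?thesis using u assms(2) by (simp add: insert_commute)
  qed
  with len vs(4) have "graph_cycle E vs" by (simp add: graph_cycle_def)
  with assms(1) show False by blast
qed

definition edges_within :: "'a set set \<Rightarrow> 'a set \<Rightarrow> 'a set set"
  where "edges_within F C = {e \<in> F. e \<subseteq> C}"

text \<open>A walk from \<open>x\<close> never leaves the component of \<open>x\<close>, so neither
  do its edges.\<close>

lemma component_connected_within:
  assumes "(x, y) \<in> (adj F)\<^sup>*"
  shows "(x, y) \<in> (adj (edges_within F (component F x)))\<^sup>*"
  using assms
proof (induction rule: rtrancl_induct)
  case (step y z)
  have "(x, z) \<in> (adj F)\<^sup>*" using step.hyps by (rule rtrancl_into_rtrancl)
  with step.hyps have "(y, z) \<in> adj (edges_within F (component F x))"
    by (auto simp: adj_def edges_within_def mem_component)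
  with step.IH show ?case by (rule rtrancl_into_rtrancl)
qed simp

lemma component_connected:
  assumes "C \<in> components V F" "x \<in> C" "y \<in> C"
  shows "(x, y) \<in> (adj (edges_within F C))\<^sup>*"
proof -
  obtain w where C: "C = component F w" using assms(1) by (auto simp: components_def)
  then have "(w, x) \<in> (adj (edges_within F C))\<^sup>*" "(w, y) \<in> (adj (edges_within F C))\<^sup>*"
    using component_connected_within[of w _ F] assms by (auto simp: mem_component)
  then show ?thesis by (meson adj_rtrancl_sym rtrancl_trans)
qed

section \<open>Forests: bridges, intersections of subtrees, component counts\<close>

text \<open>Connectedness is left out so that the locale can also be instantiated by a component
  together with its inner edges.\<close>

locale forest =
  fixes V :: "'a set" and E :: "'a set set"
  assumes finite_V: "finite V"
    and edges: "\<And>e. e \<in> E \<Longrightarrow> e \<subseteq> V \<and> card e = 2"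
    and acyclic: "\<nexists>vs. graph_cycle E vs"
begin

lemma finite_E: "finite E"
  using finite_V edges by (meson Pow_iff finite_Pow_iff finite_subset subsetI)

lemma edgeE:
  assumes "e \<in> E"
  obtains u v where "e = {u, v}" "u \<noteq> v"
  using edges[OF assms] by (auto simp: card_2_iff)

lemma Union_subset: "F \<subseteq> E \<Longrightarrow> \<Union>F \<subseteq> V"
  using edges by blast

lemma bridge:
  assumes "{u, v} \<in> E" "F \<subseteq> E - {{u, v}}"
  shows "(u, v) \<notin> (adj F)\<^sup>*"
proof -
  have "u \<noteq> v" using edges[OF assms(1)] by auto
  from acyclic_edge_is_bridge[OF acyclic assms(1) this] assms(2) show ?thesis
    using adj_rtrancl_mono by metis
qed

text \<open>Simplicity and acyclicity are inherited from \<open>E\<close>, so only nonemptiness and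
  connectedness remain to be checked.\<close>

lemma tree_edge_set_iff:
  assumes "S \<subseteq> E"
  shows "tree_edge_set S \<longleftrightarrow> S \<noteq> {} \<and> (\<forall>x\<in>\<Union>S. \<forall>y\<in>\<Union>S. (x, y) \<in> (adj S)\<^sup>*)"
proof -
  have "\<nexists>vs. graph_cycle S vs"
    using acyclic assms by (auto simp: graph_cycle_def)
  moreover have "simple_graph (\<Union>S) S"
    using assms edges finite_subset[OF Union_subset[OF assms] finite_V]
    by (auto simp: simple_graph_def)
  moreover have "\<Union>S \<noteq> {}" if "S \<noteq> {}"
  proof -
    obtain e where "e \<in> S" using \<open>S \<noteq> {}\<close> by blast
    moreover have "e \<noteq> {}" using edges[of e] \<open>e \<in> S\<close> assms by auto
    ultimately show ?thesis by blast
  qed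
  ultimately show ?thesis
    by (auto simp: tree_edge_set_def is_tree_def connected_graph_iff simp del: Sup_bot_conv)
qed

text \<open>An edge \<open>{u, v}\<close> of \<open>S\<^sub>1\<close> outside \<open>S\<^sub>2\<close> that separates \<open>x\<close> from \<open>y\<close> in \<open>S\<^sub>1\<close> would not be a bridge:
  the detour from \<open>u\<close> to \<open>v\<close> runs through the path from \<open>x\<close> to \<open>y\<close> in \<open>S\<^sub>2\<close>.\<close>

lemma adj_rtrancl_Int:
  assumes "S1 \<subseteq> E" "S2 \<subseteq> E" "(x, y) \<in> (adj S1)\<^sup>*" "(x, y) \<in> (adj S2)\<^sup>*"
  shows "(x, y) \<in> (adj (S1 \<inter> S2))\<^sup>*"
proof -
  \<comment> \<open>The edges of \<open>S1 - S2\<close> are deleted one at a time, keeping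
    \<open>x\<close> and \<open>y\<close> joined throughout.\<close>
  have "finite D \<Longrightarrow> D \<subseteq> S1 - S2 \<Longrightarrow> (x, y) \<in> (adj (S1 - D))\<^sup>*" for D
  proof (induction D rule: finite_induct)
    case (insert e D)
    then have e: "e \<in> E" "e \<in> S1" "e \<notin> S2" using assms by auto
    obtain u v where uv: "e = {u, v}" using edgeE[OF e(1)] by metis
    let ?R = "S1 - insert e D"
    have "(x, y) \<in> (adj (insert {u, v} ?R))\<^sup>*"
      using insert e uv by (metis Diff_insert Diff_iff insert_Diff insert_subset)
    from adj_rtrancl_insert_cases[OF this] show ?case
    proof (elim disjE conjE)
      assume R: "(x, u) \<in> (adj ?R)\<^sup>*" "(v, y) \<in> (adj ?R)\<^sup>*"
      have E': "?R \<subseteq> E - {e}" "S2 \<subseteq> E - {e}" using assms e by auto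
      have "(u, v) \<in> (adj (E - {e}))\<^sup>*"
        using adj_rtrancl_mono[OF E'(1) adj_rtrancl_sym[OF R(1)]]
          adj_rtrancl_mono[OF E'(2) assms(4)] adj_rtrancl_mono[OF E'(1) adj_rtrancl_sym[OF R(2)]]
        by (meson rtrancl_trans)
      then show ?thesis using bridge[of u v "E - {e}"] e uv by auto
    next
      assume R: "(x, v) \<in> (adj ?R)\<^sup>*" "(u, y) \<in> (adj ?R)\<^sup>*"
      have E': "?R \<subseteq> E - {e}" "S2 \<subseteq> E - {e}" using assms e by auto
      have "(u, v) \<in> (adj (E - {e}))\<^sup>*"
        using adj_rtrancl_mono[OF E'(1) R(2)] adj_rtrancl_mono[OF E'(1) R(1)]
          adj_rtrancl_mono[OF E'(2) assms(4)]
        by (meson rtrancl_trans adj_rtrancl_sym)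
      then show ?thesis using bridge[of u v "E - {e}"] e uv by auto
    qed
  qed (use assms in simp)
  from this[of "S1 - S2"] show ?thesis
    using finite_subset[OF assms(1) finite_E] by (simp add: Diff_Diff_Int)
qed

text \<open>This closure property is what makes a least subtree around a given nonempty edge set
  exist.\<close>

lemma tree_edge_set_Int:
  assumes "S1 \<subseteq> E" "S2 \<subseteq> E" "tree_edge_set S1" "tree_edge_set S2" "S1 \<inter> S2 \<noteq> {}"
  shows "tree_edge_set (S1 \<inter> S2)"
proof -
  have "(x, y) \<in> (adj (S1 \<inter> S2))\<^sup>*" if "x \<in> \<Union>(S1 \<inter> S2)" "y \<in> \<Union>(S1 \<inter> S2)" for x y
    using that assms by (intro adj_rtrancl_Int) (auto simp: tree_edge_set_iff)
  then show ?thesis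
    using assms by (subst tree_edge_set_iff) auto
qed

text \<open>The ends of a new forest edge lie in different components by \<open>bridge\<close>, so
  each edge merges exactly two components and lowers their number by one.\<close>

lemma card_components:
  assumes "F \<subseteq> E"
  shows "card (components V F) + card F = card V"
proof -
  have "finite F \<Longrightarrow> F \<subseteq> E \<Longrightarrow> card (components V F) + card F = card V" for F
  proof (induction F rule: finite_induct)
    case empty
    have "adj {} = ({} :: ('a \<times> 'a) set)" by (simp add: adj_def)
    then have "component {} = (\<lambda>x :: 'a. {x})" by (simp add: component_def fun_eq_iff)
    then show ?case by (simp add: components_def card_image)
  next
    case (insert e F)
    obtain u v where uv: "e = {u, v}" using edgeE insert.prems by (metis insert_subset)
    have V: "u \<in> V" "v \<in> V" using edges[of e] insert.prems uv by auto
    have "(u, v) \<notin> (adj F)\<^sup>*"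
      using bridge[of u v F] insert uv by auto
    then have neq: "component F u \<noteq> component F v" by (simp add: component_eq_iff)
    let ?C = "components V F" and ?D = "{component F u, component F v}"
    let ?N = "component F u \<union> component F v"
    have D: "?D \<subseteq> ?C" using V by (auto simp: components_def)
    have merge: "component (insert e F) x = (if component F x \<in> ?D then ?N else component F x)" for x
    proof -
      have mono: "(a, b) \<in> (adj (insert e F))\<^sup>*" if "(a, b) \<in> (adj F)\<^sup>*" for a b
        using that by (rule adj_rtrancl_mono[rotated]) auto
      have uve: "(u, v) \<in> (adj (insert e F))\<^sup>*" using uv by (auto simp: adj_def)
      have "(x, y) \<in> (adj (insert e F))\<^sup>* \<longleftrightarrow> (x, y) \<in> (adj F)\<^sup>* \<or>
          ((x, u) \<in> (adj F)\<^sup>* \<and> (v, y) \<in> (adj F)\<^sup>*) \<or> ((x, v) \<in> (adj F)\<^sup>* \<and> (u, y) \<in> (adj F)\<^sup>*)" for y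
        using adj_rtrancl_insert_cases[of x y u v F] uv mono uve adj_rtrancl_sym[OF uve]
        by (meson rtrancl_trans)
      then show ?thesis
        unfolding set_eq_iff insert_iff component_eq_iff mem_component
        by (auto simp: mem_component component_eq_iff dest: adj_rtrancl_sym
            intro: rtrancl_trans adj_rtrancl_sym)
    qed
    have "components V (insert e F) = insert ?N (?C - ?D)"
    proof -
      have "components V (insert e F) = (\<lambda>C. if C \<in> ?D then ?N else C) ` ?C"
        unfolding components_def image_image merge ..
      also have "\<dots> = insert ?N (?C - ?D)" using D by auto
      finally show ?thesis .
    qed
    \<comment> \<open>Hence inserting \<open>?N\<close> adds a new element, and the count changes by
      two down and one up.\<close>
    moreover have "?N \<notin> ?C - ?D"
    proof
      assume N: "?N \<in> ?C - ?D"
      then have "?N = component F u"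
        using components_disjoint[of ?N V F "component F u" u] D by simp
      with N show False by simp
    qed
    moreover have fin: "finite ?C" using finite_V by (simp add: components_def)
    moreover have "card (?C - ?D) + 2 = card ?C"
    proof -
      have "card ?D = 2" using neq by simp
      moreover have "card ?D \<le> card ?C" using D fin by (intro card_mono)
      ultimately show ?thesis using card_Diff_subset[OF _ D] by simp
    qed
    ultimately have "card (components V (insert e F)) + 1 = card ?C" by simp
    then show ?case using insert by simp
  qed
  then show ?thesis using assms finite_subset[OF assms finite_E] by blast
qed

text \<open>A component with its inner edges is a forest with a single component, so
  \<open>card_components\<close> applies to it.\<close>

lemma card_edges_within:
  assumes "F \<subseteq> E" "C \<in> components V F"
  shows "Suc (card (edges_within F C)) = card C"
proof -
  have CV: "C \<subseteq> V"
    using assms component_subset[OF Union_subset[OF assms(1)]] by (auto simp: components_def)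
  interpret C: forest C "edges_within F C"
  proof
    show "finite C" using CV finite_V by (rule finite_subset)
    show "e \<subseteq> C \<and> card e = 2" if "e \<in> edges_within F C" for e
      using that assms edges by (auto simp: edges_within_def)
    show "\<nexists>vs. graph_cycle (edges_within F C) vs"
      using acyclic assms(1) by (auto simp: graph_cycle_def edges_within_def)
  qed
  have "C \<noteq> {}" using assms(2) by (auto simp: components_def)
  moreover have "component (edges_within F C) x = C" if "x \<in> C" for x
    using component_subset[OF C.Union_subset[OF order.refl] that] component_connected[OF assms(2) that]
    by (auto simp: mem_component)
  ultimately have "components C (edges_within F C) = {C}"
    by (auto simp: components_def)
  then show ?thesis using C.card_components[OF order.refl] by simp
qed

end

text \<open>Removing \<open>F\<close> leaves an arbitrary subset of \<open>E - F\<close>. The guard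
  is essential: for \<open>k < card F\<close> truncated subtraction would make the binomial
  coefficient 1.\<close>

lemma card_between:
  assumes "finite E" "F \<subseteq> E"
  shows "card {B. F \<subseteq> B \<and> B \<subseteq> E \<and> card B = k} =
    (if card F \<le> k then (card E - card F) choose (k - card F) else 0)"
proof -
  have finB: "finite B" if "B \<subseteq> E" for B using that assms(1) by (rule finite_subset)
  show ?thesis
  proof (cases "card F \<le> k")
    case True
    have "bij_betw (\<lambda>B. B - F) {B. F \<subseteq> B \<and> B \<subseteq> E \<and> card B = k}
        {D. D \<subseteq> E - F \<and> card D = k - card F}"
    proof (rule bij_betw_byWitness[where f' = "\<lambda>D. D \<union> F"])
      show "(\<lambda>B. B - F) ` {B. F \<subseteq> B \<and> B \<subseteq> E \<and> card B = k} \<subseteq>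
          {D. D \<subseteq> E - F \<and> card D = k - card F}"
        using finB[OF assms(2)] by (auto simp: card_Diff_subset)
      show "(\<lambda>D. D \<union> F) ` {D. D \<subseteq> E - F \<and> card D = k - card F} \<subseteq>
          {B. F \<subseteq> B \<and> B \<subseteq> E \<and> card B = k}"
      proof clarify
        fix D assume D: "D \<subseteq> E - F" "card D = k - card F"
        then have "finite D" "finite F" "D \<inter> F = {}" using finB assms(2) by auto
        then have "card (D \<union> F) = k" using D(2) True by (simp add: card_Un_disjoint)
        then show "F \<subseteq> D \<union> F \<and> D \<union> F \<subseteq> E \<and> card (D \<union> F) = k" using D assms(2) by auto
      qed
    qed auto
    then have "card {B. F \<subseteq> B \<and> B \<subseteq> E \<and> card B = k} = card {D. D \<subseteq> E - F \<and> card D = k - card F}"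
      by (rule bij_betw_same_card)
    also have "\<dots> = card (E - F) choose (k - card F)"
      using assms(1) by (intro n_subsets) auto
    finally show ?thesis
      using True finB[OF assms(2)] assms(2) by (simp add: card_Diff_subset)
  next
    case False
    then have "{B. F \<subseteq> B \<and> B \<subseteq> E \<and> card B = k} = {}"
      using card_mono[OF finB] by auto
    then show ?thesis using False by (simp only: card.empty if_False)
  qed
qed

section \<open>Trees: hulls and connectors\<close>

locale tree = forest +
  assumes nonempty: "V \<noteq> {}"
    and connected: "\<And>x y. x \<in> V \<Longrightarrow> y \<in> V \<Longrightarrow> (x, y) \<in> (adj E)\<^sup>*"
begin

lemma card_E: "Suc (card E) = card V"
proof -
  have "component E x = V" if "x \<in> V" for x
    using component_subset[OF Union_subset[OF order.refl] that] connected[OF that]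
    by (auto simp: mem_component)
  then have "components V E = {V}" using nonempty by (auto simp: components_def)
  then show ?thesis using card_components[OF order.refl] by simp
qed

lemma tree_edge_set_E: "E \<noteq> {} \<Longrightarrow> tree_edge_set E"
  using connected Union_subset[OF order.refl] by (simp add: tree_edge_set_iff subset_iff)

text \<open>For nonempty \<open>A \<subseteq> E\<close> this is \<open>A\<close> together with its
  connector. As an intersection it can be stated before a least subtree is known to exist.\<close>

definition tree_hull :: "'a set set \<Rightarrow> 'a set set"
  where "tree_hull A = \<Inter>{S. A \<subseteq> S \<and> S \<subseteq> E \<and> tree_edge_set S}"

lemma tree_hull_minimal: "A \<subseteq> S \<Longrightarrow> S \<subseteq> E \<Longrightarrow> tree_edge_set S \<Longrightarrow> tree_hull A \<subseteq> S"
  by (auto simp: tree_hull_def)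

lemma subset_tree_hull: "A \<subseteq> tree_hull A"
  by (auto simp: tree_hull_def)

text \<open>A subtree \<open>M\<close> around \<open>A\<close> with the fewest edges lies in every
  other such subtree \<open>S\<close>: \<open>M \<inter> S\<close> is again one, since it contains
  the nonempty \<open>A\<close>, and it cannot be smaller than \<open>M\<close>.\<close>

lemma tree_hull:
  assumes "A \<subseteq> E" "A \<noteq> {}"
  shows "tree_hull A \<subseteq> E" "tree_edge_set (tree_hull A)"
proof -
  let ?P = "\<lambda>S. A \<subseteq> S \<and> S \<subseteq> E \<and> tree_edge_set S"
  have "?P E" using assms tree_edge_set_E by auto
  from ex_has_least_nat[of ?P, OF this, of card]
  obtain M where M: "?P M" "\<And>S. ?P S \<Longrightarrow> card M \<le> card S" by auto
  have "M \<subseteq> S" if S: "?P S" for S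
  proof -
    have "?P (M \<inter> S)" using M(1) S assms tree_edge_set_Int[of M S] by auto
    then have "card M \<le> card (M \<inter> S)" by (rule M(2))
    then have "M \<inter> S = M"
      using M(1) finite_subset[OF _ finite_E] by (intro card_seteq) auto
    then show ?thesis by blast
  qed
  then have "tree_hull A = M" using M(1) by (auto simp: tree_hull_def)
  then show "tree_hull A \<subseteq> E" "tree_edge_set (tree_hull A)" using M(1) by auto
qed

text \<open>The hull minus \<open>A\<close> lies in every candidate \<open>K\<close>, so it is a
  least candidate and therefore the only minimal one.\<close>

lemma connector_eq:
  assumes "A \<subseteq> E" "A \<noteq> {}"
  shows "connector E A = tree_hull A - A"
proof -
  note H = tree_hull[OF assms]
  have least: "tree_hull A - A \<subseteq> K" if "K \<subseteq> E - A" "tree_edge_set (A \<union> K)" for K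
    using tree_hull_minimal[of A "A \<union> K"] that assms by auto
  have un: "A \<union> (tree_hull A - A) = tree_hull A" using subset_tree_hull[of A] by auto
  show ?thesis
    unfolding connector_def
  proof (rule the_equality)
    show "tree_hull A - A \<subseteq> E - A \<and> tree_edge_set (A \<union> (tree_hull A - A)) \<and>
        \<not> (\<exists>K'\<subset>tree_hull A - A. tree_edge_set (A \<union> K'))"
    proof (intro conjI notI)
      show "tree_hull A - A \<subseteq> E - A" using H(1) by blast
      show "tree_edge_set (A \<union> (tree_hull A - A))" using H(2) un by simp
      assume "\<exists>K'\<subset>tree_hull A - A. tree_edge_set (A \<union> K')"
      then obtain K' where K': "K' \<subset> tree_hull A - A" "tree_edge_set (A \<union> K')" by blast
      then have "K' \<subseteq> E - A" using H(1) by blast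
      then show False using least[OF _ K'(2)] K'(1) by blast
    qed
    fix K assume K: "K \<subseteq> E - A \<and> tree_edge_set (A \<union> K) \<and> \<not> (\<exists>K'\<subset>K. tree_edge_set (A \<union> K'))"
    then have "tree_hull A - A \<subseteq> K" using least by blast
    moreover have "\<not> tree_hull A - A \<subset> K" using K H(2) un by metis
    ultimately show "K = tree_hull A - A" by blast
  qed
qed

lemma card_connector:
  assumes "A \<subseteq> E" "A \<noteq> {}"
  shows "card A + card (connector E A) = card (tree_hull A)"
proof -
  have fin: "finite (tree_hull A)" using tree_hull(1)[OF assms] finite_E by (rule finite_subset)
  then show ?thesis
    using subset_tree_hull[of A] card_mono[OF fin subset_tree_hull]
    by (simp add: connector_eq[OF assms] card_Diff_subset finite_subset)
qed

text \<open>The edges of \<open>F\<close> inside a component form a subtree as soon as there are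
  any, so they contain the hull of each nonempty subset. Conversely, a hull contained in
  \<open>F\<close> is connected and stays in one component.\<close>

lemma within_component_iff:
  assumes "F \<subseteq> E" "A \<subseteq> E" "A \<noteq> {}"
  shows "(\<exists>C\<in>components V F. A \<subseteq> edges_within F C) \<longleftrightarrow> tree_hull A \<subseteq> F"
proof
  assume "\<exists>C\<in>components V F. A \<subseteq> edges_within F C"
  then obtain C where C: "C \<in> components V F" "A \<subseteq> edges_within F C" by blast
  have sub: "edges_within F C \<subseteq> E" "edges_within F C \<subseteq> F"
    using assms(1) by (auto simp: edges_within_def)
  have "tree_edge_set (edges_within F C)"
    unfolding tree_edge_set_iff[OF sub(1)]
  proof (intro conjI ballI)
    show "edges_within F C \<noteq> {}" using C assms(3) by blast
    fix x y assume "x \<in> \<Union>(edges_within F C)" "y \<in> \<Union>(edges_within F C)"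
    then show "(x, y) \<in> (adj (edges_within F C))\<^sup>*"
      by (intro component_connected[OF C(1)]) (auto simp: edges_within_def)
  qed
  then show "tree_hull A \<subseteq> F" using tree_hull_minimal[OF C(2) sub(1)] sub(2) by blast
next
  assume F: "tree_hull A \<subseteq> F"
  note H = tree_hull[OF assms(2,3)]
  obtain e where "e \<in> A" using assms(3) by blast
  then obtain x where x: "x \<in> \<Union>(tree_hull A)" "x \<in> V"
    using subset_tree_hull[of A] edges[of e] assms(2) edgeE[of e] by (metis UnionI insertI1 subsetD)
  have "A \<subseteq> edges_within F (component F x)"
  proof
    fix e assume e: "e \<in> A"
    then have "e \<in> tree_hull A" using subset_tree_hull by blast
    moreover have "(x, y) \<in> (adj F)\<^sup>*" if "y \<in> \<Union>(tree_hull A)" for y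
      using H x that tree_edge_set_iff[OF H(1)] adj_rtrancl_mono[OF F] by blast
    ultimately show "e \<in> edges_within F (component F x)"
      using F unfolding edges_within_def mem_component[symmetric] by blast
  qed
  then show "\<exists>C\<in>components V F. A \<subseteq> edges_within F C"
    using x by (auto simp: components_def)
qed

text \<open>A component \<open>C\<close> has \<open>card C - 1\<close> inner edges, so its binomial
  coefficient counts \<open>a\<close>-subsets of them. As \<open>a > 0\<close>, no set is counted
  for two components.\<close>

lemma sum_components_choose:
  assumes "F \<subseteq> E" "a > 0"
  shows "(\<Sum>C\<in>components V F. (card C - 1) choose a) =
    card {A. A \<subseteq> E \<and> card A = a \<and> tree_hull A \<subseteq> F}"
proof -
  let ?X = "\<lambda>C. {A. A \<subseteq> edges_within F C \<and> card A = a}"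
  have finW: "finite (edges_within F C)" for C
    using finite_subset[OF assms(1) finite_E] by (simp add: edges_within_def)
  have "(\<Sum>C\<in>components V F. (card C - 1) choose a) = (\<Sum>C\<in>components V F. card (?X C))"
  proof (rule sum.cong[OF refl])
    fix C assume "C \<in> components V F"
    then have "card C - 1 = card (edges_within F C)" using card_edges_within[OF assms(1)] by fastforce
    then show "(card C - 1) choose a = card (?X C)" using n_subsets[OF finW] by simp
  qed
  also have "\<dots> = card (\<Union>C\<in>components V F. ?X C)"
  proof (rule card_UN_disjoint[symmetric])
    show "finite (components V F)" using finite_V by (simp add: components_def)
    show "\<forall>C\<in>components V F. finite (?X C)" using finW by simp
    show "\<forall>C\<in>components V F. \<forall>D\<in>components V F. C \<noteq> D \<longrightarrow> ?X C \<inter> ?X D = {}"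
    proof (intro ballI impI, rule ccontr)
      fix C D assume CD: "C \<in> components V F" "D \<in> components V F" "C \<noteq> D" "?X C \<inter> ?X D \<noteq> {}"
      then obtain A where A: "A \<subseteq> edges_within F C" "A \<subseteq> edges_within F D" "card A = a" by blast
      then obtain e where e: "e \<in> A" using assms(2) by fastforce
      then obtain u v where "e = {u, v}"
        using A(1) assms(1) edgeE[of e] unfolding edges_within_def by blast
      then have "u \<in> C" "u \<in> D" using A e by (auto simp: edges_within_def)
      then show False using components_disjoint[OF CD(1,2)] CD(3) by blast
    qed
  qed
  also have "(\<Union>C\<in>components V F. ?X C) = {A. A \<subseteq> E \<and> card A = a \<and> tree_hull A \<subseteq> F}"
  proof (rule set_eqI)
    fix A
    have "A \<subseteq> E" if "A \<subseteq> edges_within F C" for C using that assms(1) by (auto simp: edges_within_def)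
    moreover have "A \<noteq> {}" if "card A = a" using that assms(2) by auto
    ultimately show "A \<in> (\<Union>C\<in>components V F. ?X C) \<longleftrightarrow> A \<in> {A. A \<subseteq> E \<and> card A = a \<and> tree_hull A \<subseteq> F}"
      using within_component_iff[OF assms(1), of A] by auto
  qed
  finally show ?thesis .
qed

section \<open>Leaf edges and hulls\<close>

lemma tree_edge_set_remove_leaf:
  assumes "S \<subseteq> E" "tree_edge_set S" "e \<in> leaf_edges S" "S - {e} \<noteq> {}"
  shows "tree_edge_set (S - {e})"
proof -
  obtain v where v: "e \<in> S" "v \<in> e" "card {e' \<in> S. v \<in> e'} = 1"
    using assms(3) by (auto simp: leaf_edges_def)
  obtain u where uv: "e = {u, v}"
    using edgeE[of e] v(1,2) assms(1) by (metis insert_commute insertE singletonD subsetD)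
  have "{e' \<in> S. v \<in> e'} = {e}"
    using v by (metis (mono_tags, lifting) card_1_singletonE mem_Collect_eq singletonD)
  then have isolated: "v \<notin> \<Union>(S - {e})" by auto
  have no_path: "y = v" if "(v, y) \<in> (adj (S - {e}))\<^sup>*" for y
    using that
  proof (induction rule: rtrancl_induct)
    case (step y z)
    then show ?case using isolated by (auto simp: adj_def)
  qed simp
  have "(x, y) \<in> (adj (S - {e}))\<^sup>*" if x: "x \<in> \<Union>(S - {e})" and y: "y \<in> \<Union>(S - {e})" for x y
  proof -
    have "(x, y) \<in> (adj S)\<^sup>*"
      using x y assms(2) tree_edge_set_iff[OF assms(1)] by blast
    then have "(x, y) \<in> (adj (insert {u, v} (S - {e})))\<^sup>*"
      using v(1) uv by (simp add: insert_absorb)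
    \<comment> \<open>A connection through \<open>e\<close> would join \<open>x\<close> or
      \<open>y\<close> to \<open>v\<close> inside \<open>S - {e}\<close>, where \<open>v\<close> is
      isolated.\<close>
    from adj_rtrancl_insert_cases[OF this] show ?thesis
      using no_path[of y] no_path[of x] isolated x y adj_rtrancl_sym by metis
  qed
  then show ?thesis using assms by (subst tree_edge_set_iff) auto
qed

text \<open>A maximal proper subtree of \<open>S\<close> above \<open>H\<close> misses only one edge of \<open>S\<close>, which is then a leaf edge.\<close>

lemma leaf_edge_outside_subtree:
  assumes "S \<subseteq> E" "tree_edge_set S" "H \<subset> S" "tree_edge_set H"
  shows "\<exists>e\<in>leaf_edges S. e \<notin> H"
proof -
  let ?P = "\<lambda>M. H \<subseteq> M \<and> M \<subset> S \<and> tree_edge_set M"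
  have finS: "finite S" using assms(1) finite_E by (rule finite_subset)
  have "?P H" using assms by simp
  moreover have "\<forall>M. ?P M \<longrightarrow> card M < Suc (card S)"
    using finS by (auto intro: card_mono le_imp_less_Suc)
  ultimately obtain M where M: "?P M" "\<And>N. ?P N \<Longrightarrow> card N \<le> card M"
    using ex_has_greatest_nat[of ?P H card "Suc (card S)"] by (metis less_imp_le)
  have ME: "M \<subseteq> E" using M(1) assms(1) by blast
  note treeM = tree_edge_set_iff[OF ME, THEN iffD1, OF M(1)[THEN conjunct2, THEN conjunct2]]
  obtain e0 where e0: "e0 \<in> M" using treeM by blast
  obtain x0 where x0: "x0 \<in> e0" using edgeE[of e0] e0 ME by blast
  \<comment> \<open>Some edge of \<open>S\<close> outside \<open>M\<close> touches \<open>M\<close>;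
    otherwise a walk in \<open>S\<close> that starts in \<open>M\<close> could never leave
    it.\<close>
  have "\<exists>e\<in>S - M. e \<inter> \<Union>M \<noteq> {}"
  proof (rule ccontr)
    assume "\<not> ?thesis"
    then have none: "e \<in> M" if "e \<in> S" "y \<in> e" "y \<in> \<Union>M" for e y using that by auto
    have stay: "y \<in> \<Union>M" if "(x0, y) \<in> (adj S)\<^sup>*" for y
      using that
    proof (induction rule: rtrancl_induct)
      case base
      show ?case using e0 x0 by blast
    next
      case (step y z)
      then have "{y, z} \<in> S" "y \<in> \<Union>M" by (simp_all add: adj_def)
      then have "{y, z} \<in> M" using none[of "{y, z}" y] by simp
      then show ?case by blast
    qed
    obtain e where e: "e \<in> S" "e \<notin> M" using M(1) by blast
    obtain y where y: "y \<in> e" using edgeE[of e] e assms(1) by blast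
    have "(x0, y) \<in> (adj S)\<^sup>*"
      using tree_edge_set_iff[OF assms(1)] assms(2) e y e0 x0 M(1) by blast
    then show False using none[OF e(1) y stay] e(2) by blast
  qed
  then obtain e u where e: "e \<in> S" "e \<notin> M" "u \<in> e" "u \<in> \<Union>M" by blast
  obtain v where uv: "e = {u, v}"
    using edgeE[of e] e assms(1) by (metis insert_commute insertE singletonD subsetD)
  have eE: "insert e M \<subseteq> E" using e(1) assms(1) ME by blast
  have step: "(u, v) \<in> (adj (insert e M))\<^sup>*" using uv by (auto simp: adj_def)
  have reach: "(u, y) \<in> (adj (insert e M))\<^sup>*" if "y \<in> \<Union>(insert e M)" for y
  proof (cases "y \<in> \<Union>M")
    case True
    then have "(u, y) \<in> (adj M)\<^sup>*" using treeM e(4) by blast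
    then show ?thesis by (rule adj_rtrancl_mono[rotated]) blast
  next
    case False
    then have "y = u \<or> y = v" using that uv by blast
    then show ?thesis using step by auto
  qed
  have "tree_edge_set (insert e M)"
    unfolding tree_edge_set_iff[OF eE] using reach adj_rtrancl_sym rtrancl_trans by (metis insert_not_empty)
  moreover have "card (insert e M) > card M"
    using e(2) finite_subset[OF ME finite_E] by simp
  ultimately have S: "S = insert e M"
    using M(1) M(2)[of "insert e M"] e(1) by (auto simp: psubset_eq)
  \<comment> \<open>If both ends of \<open>e\<close> lay in \<open>M\<close>, then \<open>e\<close>
    would not be a bridge. So \<open>e\<close> is the only edge of \<open>S\<close> at
    \<open>v\<close>.\<close>
  have "v \<notin> \<Union>M"
  proof
    assume "v \<in> \<Union>M"
    then have "(u, v) \<in> (adj M)\<^sup>*" using treeM e(4) by blast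
    moreover have "M \<subseteq> E - {{u, v}}" using ME e(2) uv by auto
    ultimately show False using bridge[of u v M] e(1) assms(1) uv by blast
  qed
  then have "{e' \<in> S. v \<in> e'} = {e}" using S uv by auto
  then have "e \<in> leaf_edges S" using e(1) uv by (auto simp: leaf_edges_def intro!: bexI[of _ v])
  moreover have "e \<notin> H" using e(2) M(1) by blast
  ultimately show ?thesis by blast
qed

text \<open>A leaf edge of \<open>S\<close> missing from \<open>A\<close> could be deleted, giving a
  smaller subtree around \<open>A\<close>. Conversely, a hull properly inside \<open>S\<close> would
  miss a leaf edge of \<open>S\<close>.\<close>

lemma tree_hull_eq_iff:
  assumes "S \<subseteq> E" "tree_edge_set S" "A \<subseteq> E" "A \<noteq> {}"
  shows "tree_hull A = S \<longleftrightarrow> leaf_edges S \<subseteq> A \<and> A \<subseteq> S"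
proof
  assume H: "tree_hull A = S"
  have "e \<in> A" if e: "e \<in> leaf_edges S" for e
  proof (rule ccontr)
    assume "e \<notin> A"
    then have A: "A \<subseteq> S - {e}" using H subset_tree_hull by blast
    then have "tree_edge_set (S - {e})"
      using tree_edge_set_remove_leaf[OF assms(1,2) e] assms(4) by blast
    then have "S \<subseteq> S - {e}" using tree_hull_minimal[OF A] assms(1) H by blast
    then show False using e by (auto simp: leaf_edges_def)
  qed
  then show "leaf_edges S \<subseteq> A \<and> A \<subseteq> S" using H subset_tree_hull by blast
next
  assume A: "leaf_edges S \<subseteq> A \<and> A \<subseteq> S"
  then have "tree_hull A \<subseteq> S" using tree_hull_minimal assms by blast
  then show "tree_hull A = S"
    using leaf_edge_outside_subtree[OF assms(1,2), of "tree_hull A"] tree_hull(2)[OF assms(3,4)] A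
      subset_tree_hull[of A] by blast
qed

text \<open>Without leaf edges, \<open>S\<close> would be the hull of each of its single edges,
  hence a single edge, which is a leaf edge.\<close>

lemma leaf_edges_nonempty:
  assumes "S \<subseteq> E" "tree_edge_set S"
  shows "leaf_edges S \<noteq> {}"
proof
  assume none: "leaf_edges S = {}"
  obtain e where e: "e \<in> S" using assms by (auto simp: tree_edge_set_def)
  then obtain u v where uv: "e = {u, v}" using edgeE assms(1) by blast
  have "{e} \<subseteq> E" using e assms(1) by blast
  then have "tree_edge_set {e}"
    using uv by (auto simp: tree_edge_set_iff adj_def insert_commute)
  moreover have "tree_hull {e} = S" using tree_hull_eq_iff[OF assms, of "{e}"] none e assms(1) by blast
  ultimately have "S = {e}" using tree_hull_minimal[of "{e}" "{e}"] subset_tree_hull[of "{e}"] \<open>{e} \<subseteq> E\<close> by blast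
  then have "e \<in> leaf_edges S" using uv by (auto simp: leaf_edges_def Collect_conv_if)
  then show False using none by blast
qed

end

section \<open>Extracting the two polynomials\<close>

lemma int_binomial_of_nat: "int_binomial (int m) (int k) = of_nat (m choose k)"
  by (simp add: int_binomial_def binomial_eq_0)

lemma powi_minus_one_of_nat: "(-1 :: rat) powi int k = (-1) ^ k"
  by (simp add: power_int_def)

text \<open>After shifting all indices by \<open>l\<close>, the trinomial identity
  \<open>choose_mult\<close> pulls \<open>I choose J\<close> out of the sum. What is left is an
  alternating row sum, which vanishes unless \<open>J = 0\<close>.\<close>

lemma alternating_binomial_inversion:
  assumes "1 \<le> l" "l \<le> i" "j \<le> i"
  shows "(\<Sum>d = 1..j. (-1) ^ (j + d) * of_nat ((i - d) choose (j - d)) *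
      (if l \<le> d then of_nat ((i - l) choose (d - l)) else 0)) = (if j = l then 1 else 0 :: rat)"
    (is "(\<Sum>d = 1..j. ?f d) = _")
proof (cases "l \<le> j")
  case False
  then have "(\<Sum>d = 1..j. ?f d) = 0" by (intro sum.neutral) auto
  then show ?thesis using False by simp
next
  case True
  define J where "J = j - l"
  define I where "I = i - l"
  have IJ: "J \<le> I" using assms True by (auto simp: I_def J_def)
  have "(\<Sum>d = 1..j. ?f d) = (\<Sum>d = l..j. ?f d)"
    by (rule sum.mono_neutral_right) (use assms in auto)
  also have "\<dots> = (\<Sum>e\<le>J. ?f (l + e))"
    by (rule sum.reindex_bij_witness[where i = "\<lambda>e. l + e" and j = "\<lambda>d. d - l"])
      (use True in \<open>auto simp: J_def\<close>)
  also have "\<dots> = (\<Sum>e\<le>J. (-1) ^ J * of_nat (I choose J) * ((-1) ^ e * of_nat (J choose e)))"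
  proof (rule sum.cong[OF refl])
    fix e assume "e \<in> {..J}"
    then have e: "e \<le> J" by simp
    \<comment> \<open>The even summand \<open>2 * l\<close> drops out of the sign.\<close>
    have "j + (l + e) = 2 * l + (J + e)" using True by (simp add: J_def)
    then have sgn: "(-1 :: rat) ^ (j + (l + e)) = (-1) ^ (J + e)" by (simp add: power_add power_mult)
    have diff: "i - (l + e) = I - e" "j - (l + e) = J - e" "l + e - l = e" by (simp_all add: I_def J_def)
    have "?f (l + e) = (-1) ^ (J + e) * (of_nat (I choose e) * of_nat ((I - e) choose (J - e)))"
      unfolding sgn diff I_def[symmetric] by simp
    also have "of_nat (I choose e) * of_nat ((I - e) choose (J - e)) =
        (of_nat (I choose J) * of_nat (J choose e) :: rat)"
      by (simp only: of_nat_mult[symmetric] choose_mult[OF e IJ])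
    finally show "?f (l + e) = (-1) ^ J * of_nat (I choose J) * ((-1) ^ e * of_nat (J choose e))"
      by (simp only: power_add mult_ac)
  qed
  also have "\<dots> = (-1) ^ J * of_nat (I choose J) * (\<Sum>e\<le>J. (-1) ^ e * of_nat (J choose e))"
    by (simp add: sum_distrib_left)
  also have "\<dots> = (if j = l then 1 else 0)"
  proof (cases "J = 0")
    case True
    then show ?thesis using \<open>l \<le> j\<close> by (simp add: J_def)
  next
    case False
    then show ?thesis using choose_alternating_sum[of J, where 'a = rat] by (simp add: J_def)
  qed
  finally show ?thesis .
qed

text \<open>For \<open>a = d\<close> and \<open>b = i - d\<close> the sign and the first binomial
  coefficient of \<open>psi\<close> depend on \<open>a + b = i\<close> only, so they factor out of
  the sum over \<open>d\<close>.\<close>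

lemma phi_eq_sum_psi:
  assumes "j \<le> i"
  shows "phi lam (int i) (int j) = (\<Sum>d = 1..j. (-1) ^ (j + d) * of_nat ((i - d) choose (j - d)) *
    psi lam (int d) (int (i - d)))"
proof -
  define Q where "Q = int_binomial (int (size lam) - 1) (int (size lam) - int (sum_mset lam) + int i)"
  define R where "R d = (\<Sum>p\<in>#lam. int_binomial (int p - 1) (int d))" for d
  have "(\<Sum>d = 1..int j. (-1) powi d * int_binomial (int i - d) (int j - d) *
         (\<Sum>p\<in>#lam. int_binomial (int p - 1) d)) =
      (\<Sum>d = 1..j. (-1) ^ d * of_nat ((i - d) choose (j - d)) * R d)"
  proof -
    have "{1..int j} = int ` {1..j}" by (simp add: image_int_atLeastAtMost)
    moreover have "int_binomial (int i - int d) (int j - int d) = of_nat ((i - d) choose (j - d))"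
      if "d \<in> {1..j}" for d
      using int_binomial_of_nat[of "i - d" "j - d"] that assms by (simp add: of_nat_diff)
    ultimately show ?thesis
      by (simp add: sum.reindex R_def powi_minus_one_of_nat)
  qed
  then have "phi lam (int i) (int j) =
      (-1) ^ (i + j) * Q * (\<Sum>d = 1..j. (-1) ^ d * of_nat ((i - d) choose (j - d)) * R d)"
    by (simp add: phi_def Let_def Q_def powi_minus_one_of_nat flip: of_nat_add)
  also have "\<dots> = (\<Sum>d = 1..j. (-1) ^ (j + d) * of_nat ((i - d) choose (j - d)) * ((-1) ^ i * Q * R d))"
    by (simp add: sum_distrib_left power_add mult_ac)
  also have "\<dots> = (\<Sum>d = 1..j. (-1) ^ (j + d) * of_nat ((i - d) choose (j - d)) *
      psi lam (int d) (int (i - d)))"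
  proof (rule sum.cong[OF refl])
    fix d assume "d \<in> {1..j}"
    then have di: "int d + int (i - d) = int i" using assms by simp
    have "psi lam (int d) (int (i - d)) = (-1) ^ i * Q * R d"
      unfolding psi_def Let_def add.assoc di by (simp add: Q_def R_def powi_minus_one_of_nat)
    then show "(-1) ^ (j + d) * of_nat ((i - d) choose (j - d)) * ((-1) ^ i * Q * R d) =
        (-1) ^ (j + d) * of_nat ((i - d) choose (j - d)) * psi lam (int d) (int (i - d))"
      by simp
  qed
  finally show ?thesis .
qed

lemma bivariate_monom_0 [simp]: "bivariate_monom 0 a b = 0"
  by (simp add: bivariate_monom_def)

lemma of_nat_bivariate_monom: "of_nat k * bivariate_monom 1 a b = bivariate_monom (of_nat k) a b"
  by (simp add: bivariate_monom_def of_nat_poly[symmetric] smult_monom of_nat_monom mult_monom)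

text \<open>Collects equal monomials. The range \<open>J\<close> may depend on \<open>i\<close>
  because the leaf count of a subtree is bounded by its number of edges.\<close>

lemma sum_bivariate_monom_group:
  assumes "finite X" "finite I" "\<And>i. i \<in> I \<Longrightarrow> finite (J i)"
    and "\<And>x. x \<in> X \<Longrightarrow> f x \<in> I \<and> g x \<in> J (f x)"
  shows "(\<Sum>x\<in>X. bivariate_monom 1 (f x) (g x)) =
    (\<Sum>i\<in>I. \<Sum>j\<in>J i. bivariate_monom (of_nat (card {x \<in> X. f x = i \<and> g x = j})) i j)"
proof -
  have "(\<Sum>x\<in>X. bivariate_monom 1 (f x) (g x)) =
      (\<Sum>p\<in>Sigma I J. \<Sum>x | x \<in> X \<and> (f x, g x) = p. bivariate_monom 1 (f x) (g x))"
    by (rule sum.group[symmetric]) (use assms in auto)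
  also have "\<dots> = (\<Sum>p\<in>Sigma I J.
      bivariate_monom (of_nat (card {x \<in> X. f x = fst p \<and> g x = snd p})) (fst p) (snd p))"
  proof (rule sum.cong[OF refl])
    fix p
    have "(\<Sum>x | x \<in> X \<and> (f x, g x) = p. bivariate_monom 1 (f x) (g x)) =
        (\<Sum>x | x \<in> X \<and> f x = fst p \<and> g x = snd p. bivariate_monom 1 (fst p) (snd p))"
      by (rule sum.cong) auto
    then show "(\<Sum>x | x \<in> X \<and> (f x, g x) = p. bivariate_monom 1 (f x) (g x)) =
        bivariate_monom (of_nat (card {x \<in> X. f x = fst p \<and> g x = snd p})) (fst p) (snd p)"
      by (simp add: of_nat_bivariate_monom)
  qed
  also have "\<dots> = (\<Sum>i\<in>I. \<Sum>j\<in>J i. bivariate_monom (of_nat (card {x \<in> X. f x = i \<and> g x = j})) i j)"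
    using assms by (subst sum.Sigma) (auto simp: split_beta)
  finally show ?thesis .
qed

section \<open>Signed sums of \<open>psi\<close> and \<open>phi\<close> over edge sets\<close>

context tree
begin

text \<open>The type of \<open>F\<close> has length \<open>n - card F\<close> and
  \<open>card E = n - 1\<close>, so the first binomial coefficient of \<open>psi\<close> has upper
  index \<open>card E - card F\<close> and lower index \<open>a + b - card F\<close>.\<close>

lemma psi_component_type:
  assumes "F \<subseteq> E" "a > 0"
  shows "psi (component_type V F) (int a) (int b) = (-1) ^ (a + b) *
    of_nat (card {B. F \<subseteq> B \<and> B \<subseteq> E \<and> card B = a + b}) *
    of_nat (card {A. A \<subseteq> E \<and> card A = a \<and> tree_hull A \<subseteq> F})"
proof -
  let ?l = "component_type V F"
  have finC: "finite (components V F)" using finite_V by (simp add: components_def)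
  have sum: "sum_mset ?l = card V"
    using component_type_partition[OF finite_V Union_subset[OF assms(1)]] by (simp add: partitions_def)
  have size: "size ?l + card F = card V"
    using card_components[OF assms(1)] by (simp add: component_type_def)
  have le: "card F \<le> card E" using assms(1) finite_E by (rule card_mono[rotated])
  have l1: "int (size ?l) - 1 = int (card E - card F)" using size card_E le by simp
  have lk: "int (size ?l) - int (card V) + int a + int b = int (a + b) - int (card F)"
    using size by simp
  have B: "int_binomial (int (size ?l) - 1) (int (size ?l) - int (card V) + int a + int b) =
      of_nat (card {B. F \<subseteq> B \<and> B \<subseteq> E \<and> card B = a + b})"
  proof (cases "card F \<le> a + b")
    case True
    then have diff: "int (a + b) - int (card F) = int (a + b - card F)" by (simp add: of_nat_diff)
    show ?thesis
      unfolding l1 lk card_between[OF finite_E assms(1)] diff using True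
      by (simp only: int_binomial_of_nat if_True)
  next
    case False
    \<comment> \<open>The lower index is negative here, so \<open>int_binomial\<close> is 0 in
      agreement with the guard of \<open>card_between\<close>.\<close>
    then show ?thesis
      unfolding l1 lk card_between[OF finite_E assms(1)] by (simp add: int_binomial_def)
  qed
  have "(\<Sum>p\<in>#?l. int_binomial (int p - 1) (int a)) =
      (\<Sum>C\<in>components V F. int_binomial (int (card C) - 1) (int a))"
    by (simp add: component_type_def sum_unfold_sum_mset image_mset.compositionality comp_def)
  also have "\<dots> = (\<Sum>C\<in>components V F. of_nat ((card C - 1) choose a))"
  proof (rule sum.cong[OF refl])
    fix C assume "C \<in> components V F"
    then have "int (card C) - 1 = int (card C - 1)" using card_edges_within[OF assms(1)] by force
    then show "int_binomial (int (card C) - 1) (int a) = of_nat ((card C - 1) choose a)"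
      by (simp only: int_binomial_of_nat)
  qed
  also have "\<dots> = of_nat (card {A. A \<subseteq> E \<and> card A = a \<and> tree_hull A \<subseteq> F})"
    by (simp only: sum_components_choose[OF assms, symmetric] of_nat_sum)
  finally show ?thesis
    using B by (simp add: psi_def Let_def sum powi_minus_one_of_nat flip: of_nat_add)
qed

text \<open>By \<open>card_connector\<close>, a hull with \<open>a + b\<close> edges means a
  connector with \<open>b\<close> edges, so this is the coefficient of the connector polynomial at
  exponents \<open>a\<close> and \<open>b\<close>.\<close>

lemma sum_psi_component_type:
  assumes "a > 0"
  shows "(\<Sum>F\<in>Pow E. (-1) ^ card F * psi (component_type V F) (int a) (int b)) =
    of_nat (card {A. A \<subseteq> E \<and> card A = a \<and> card (tree_hull A) = a + b})"
proof -
  let ?A = "{A. A \<subseteq> E \<and> card A = a}" and ?B = "{B. B \<subseteq> E \<and> card B = a + b}"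
  have fin: "finite ?A" "finite ?B" "finite (Pow E)" using finite_E by auto
  let ?s = "(-1 :: rat) ^ (a + b)"
  have "(\<Sum>F\<in>Pow E. (-1) ^ card F * psi (component_type V F) (int a) (int b)) =
      (\<Sum>F\<in>Pow E. \<Sum>A\<in>?A. \<Sum>B\<in>?B. if tree_hull A \<subseteq> F \<and> F \<subseteq> B then ?s * (-1) ^ card F else 0)"
  proof (rule sum.cong[OF refl])
    fix F assume "F \<in> Pow E"
    then have F: "F \<subseteq> E" by simp
    have B: "of_nat (card {B. F \<subseteq> B \<and> B \<subseteq> E \<and> card B = a + b}) =
        (\<Sum>B\<in>?B. if F \<subseteq> B then 1 else 0 :: rat)"
      using fin by (simp add: sum.If_cases Int_def conj_commute conj_left_commute)
    have A: "of_nat (card {A. A \<subseteq> E \<and> card A = a \<and> tree_hull A \<subseteq> F}) =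
        (\<Sum>A\<in>?A. if tree_hull A \<subseteq> F then 1 else 0 :: rat)"
      using fin by (simp add: sum.If_cases Int_def conj_assoc)
    have "(-1) ^ card F * psi (component_type V F) (int a) (int b) =
        (\<Sum>A\<in>?A. \<Sum>B\<in>?B. (-1) ^ card F * (?s * (if F \<subseteq> B then 1 else 0) *
          (if tree_hull A \<subseteq> F then 1 else 0)))"
      unfolding psi_component_type[OF F assms] A B
      by (simp only: sum_distrib_left sum_distrib_right)
    also have "\<dots> = (\<Sum>A\<in>?A. \<Sum>B\<in>?B.
        if tree_hull A \<subseteq> F \<and> F \<subseteq> B then ?s * (-1) ^ card F else 0)"
      by (intro sum.cong refl) simp
    finally show "(-1) ^ card F * psi (component_type V F) (int a) (int b) = \<dots>" .
  qed
  also have "\<dots> = (\<Sum>A\<in>?A. \<Sum>F\<in>Pow E. \<Sum>B\<in>?B.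
      if tree_hull A \<subseteq> F \<and> F \<subseteq> B then ?s * (-1) ^ card F else 0)"
    by (rule sum.swap)
  also have "\<dots> = (\<Sum>A\<in>?A. \<Sum>B\<in>?B. \<Sum>F\<in>Pow E.
      if tree_hull A \<subseteq> F \<and> F \<subseteq> B then ?s * (-1) ^ card F else 0)"
    by (intro sum.cong refl sum.swap)
  also have "\<dots> = (\<Sum>A\<in>?A. \<Sum>B\<in>?B. if tree_hull A = B then 1 else 0)"
  proof (intro sum.cong refl)
    fix A B assume "A \<in> ?A" and B: "B \<in> ?B"
    have finB: "finite B" using B finite_E by (auto intro: finite_subset)
    have "(\<Sum>F\<in>Pow E. if tree_hull A \<subseteq> F \<and> F \<subseteq> B then ?s * (-1) ^ card F else 0) =
        (\<Sum>F | tree_hull A \<subseteq> F \<and> F \<subseteq> B. ?s * (-1) ^ card F)"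
      using fin(3) B by (intro sum.mono_neutral_cong_right) auto
    also have "\<dots> = ?s * (\<Sum>F | tree_hull A \<subseteq> F \<and> F \<subseteq> B. (-1) ^ card F)"
      by (simp only: sum_distrib_left)
    also have "\<dots> = (if tree_hull A = B then 1 else 0)"
    proof -
      consider "tree_hull A \<subset> B" | "tree_hull A = B" | "\<not> tree_hull A \<subseteq> B" by blast
      then show ?thesis
      proof cases
        case 1
        then show ?thesis using sum_minus_one_card_interval[OF finB 1] by simp
      next
        case 2
        then have "{F. tree_hull A \<subseteq> F \<and> F \<subseteq> B} = {B}" by blast
        \<comment> \<open>Since \<open>card B = a + b\<close>, the two signs multiply to 1.\<close>
        then show ?thesis using 2 B by (simp add: power_mult_distrib[symmetric])
      next
        case 3
        then have "{F. tree_hull A \<subseteq> F \<and> F \<subseteq> B} = {}" by blast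
        then show ?thesis using 3 by (simp only: sum.empty) auto
      qed
    qed
    finally show "(\<Sum>F\<in>Pow E. if tree_hull A \<subseteq> F \<and> F \<subseteq> B then ?s * (-1) ^ card F else 0) =
        (if tree_hull A = B then 1 else 0)" .
  qed
  also have "\<dots> = (\<Sum>A\<in>?A. if card (tree_hull A) = a + b then 1 else 0)"
  proof (rule sum.cong[OF refl])
    fix A assume A: "A \<in> ?A"
    then have "A \<noteq> {}" using assms by auto
    \<comment> \<open>As a subset of \<open>E\<close>, the hull occurs among the sets in
      \<open>?B\<close> exactly when its size is \<open>a + b\<close>.\<close>
    then have "tree_hull A \<subseteq> E" using tree_hull(1)[of A] A by blast
    then show "(\<Sum>B\<in>?B. if tree_hull A = B then 1 else 0 :: rat) =
        (if card (tree_hull A) = a + b then 1 else 0)"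
      using fin(2) by simp
  qed
  also have "\<dots> = of_nat (card {A. A \<subseteq> E \<and> card A = a \<and> card (tree_hull A) = a + b})"
    using fin by (simp add: sum.If_cases Int_def conj_assoc)
  finally show ?thesis .
qed

text \<open>By \<open>tree_hull_eq_iff\<close> these sets form the interval from
  \<open>leaf_edges S\<close> to \<open>S\<close>; \<open>d > 0\<close> keeps them nonempty.\<close>

lemma card_spanning_sets:
  assumes "S \<subseteq> E" "tree_edge_set S" "d > 0"
  shows "card {A. A \<subseteq> E \<and> card A = d \<and> tree_hull A = S} =
    (if card (leaf_edges S) \<le> d then (card S - card (leaf_edges S)) choose (d - card (leaf_edges S)) else 0)"
proof -
  have "{A. A \<subseteq> E \<and> card A = d \<and> tree_hull A = S} =
      {A. leaf_edges S \<subseteq> A \<and> A \<subseteq> S \<and> card A = d}"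
  proof (rule set_eqI)
    fix A :: "'a set set"
    have "A \<noteq> {}" if "card A = d" using that assms(3) by auto
    then show "A \<in> {A. A \<subseteq> E \<and> card A = d \<and> tree_hull A = S} \<longleftrightarrow>
        A \<in> {A. leaf_edges S \<subseteq> A \<and> A \<subseteq> S \<and> card A = d}"
      using tree_hull_eq_iff[OF assms(1,2), of A] assms(1) by blast
  qed
  then show ?thesis
    using card_between[of S "leaf_edges S" d] finite_subset[OF assms(1) finite_E]
    by (simp add: leaf_edges_def)
qed

text \<open>Through \<open>psi\<close> this is a signed sum of counts of sets \<open>A\<close> whose
  hull has \<open>i\<close> edges. Grouped by hull \<open>S\<close>, each count depends only on
  \<open>i\<close>, \<open>d\<close> and the number of leaf edges, and the inversion keeps just the
  \<open>S\<close> with \<open>j\<close> of them.\<close>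

lemma sum_phi_component_type:
  assumes "j \<le> i"
  shows "(\<Sum>F\<in>Pow E. (-1) ^ card F * phi (component_type V F) (int i) (int j)) =
    of_nat (card {S. S \<subseteq> E \<and> tree_edge_set S \<and> card S = i \<and> card (leaf_edges S) = j})"
proof -
  let ?S = "{S. S \<subseteq> E \<and> tree_edge_set S \<and> card S = i}"
  let ?c = "\<lambda>d. (-1 :: rat) ^ (j + d) * of_nat ((i - d) choose (j - d))"
  have finS: "finite ?S" using finite_E by simp
  have count: "card {A. A \<subseteq> E \<and> card A = d \<and> card (tree_hull A) = i} =
      (\<Sum>S\<in>?S. card {A. A \<subseteq> E \<and> card A = d \<and> tree_hull A = S})" if "d > 0" for d
  proof -
    have "{A. A \<subseteq> E \<and> card A = d \<and> card (tree_hull A) = i} =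
        (\<Union>S\<in>?S. {A. A \<subseteq> E \<and> card A = d \<and> tree_hull A = S})"
    proof (rule set_eqI)
      fix A :: "'a set set"
      have "A \<noteq> {}" if "card A = d" using that \<open>d > 0\<close> by auto
      then show "A \<in> {A. A \<subseteq> E \<and> card A = d \<and> card (tree_hull A) = i} \<longleftrightarrow>
          A \<in> (\<Union>S\<in>?S. {A. A \<subseteq> E \<and> card A = d \<and> tree_hull A = S})"
        using tree_hull[of A] by blast
    qed
    then show ?thesis
      using finS finite_E by (simp only:) (rule card_UN_disjoint; auto)
  qed
  have "(\<Sum>F\<in>Pow E. (-1) ^ card F * phi (component_type V F) (int i) (int j)) =
      (\<Sum>F\<in>Pow E. \<Sum>d = 1..j. ?c d * ((-1) ^ card F * psi (component_type V F) (int d) (int (i - d))))"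
    unfolding phi_eq_sum_psi[OF assms] sum_distrib_left by (simp add: mult_ac)
  also have "\<dots> = (\<Sum>d = 1..j. ?c d *
      (\<Sum>F\<in>Pow E. (-1) ^ card F * psi (component_type V F) (int d) (int (i - d))))"
    unfolding sum_distrib_left by (rule sum.swap)
  also have "\<dots> = (\<Sum>d = 1..j. \<Sum>S\<in>?S. ?c d * (if card (leaf_edges S) \<le> d
      then of_nat ((i - card (leaf_edges S)) choose (d - card (leaf_edges S))) else 0))"
  proof (rule sum.cong[OF refl])
    fix d assume d: "d \<in> {1..j}"
    then have d0: "d > 0" and di: "d + (i - d) = i" using assms by auto
    have "(\<Sum>F\<in>Pow E. (-1) ^ card F * psi (component_type V F) (int d) (int (i - d))) =
        (\<Sum>S\<in>?S. if card (leaf_edges S) \<le> d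
          then of_nat ((i - card (leaf_edges S)) choose (d - card (leaf_edges S))) else 0)"
      unfolding sum_psi_component_type[OF d0] di count[OF d0] of_nat_sum
      by (rule sum.cong) (use d0 in \<open>auto simp: card_spanning_sets\<close>)
    then show "?c d * (\<Sum>F\<in>Pow E. (-1) ^ card F * psi (component_type V F) (int d) (int (i - d))) =
        (\<Sum>S\<in>?S. ?c d * (if card (leaf_edges S) \<le> d
          then of_nat ((i - card (leaf_edges S)) choose (d - card (leaf_edges S))) else 0))"
      by (simp only: sum_distrib_left)
  qed
  also have "\<dots> = (\<Sum>S\<in>?S. \<Sum>d = 1..j. ?c d * (if card (leaf_edges S) \<le> d
      then of_nat ((i - card (leaf_edges S)) choose (d - card (leaf_edges S))) else 0))"
    by (rule sum.swap)
  also have "\<dots> = (\<Sum>S\<in>?S. if j = card (leaf_edges S) then 1 else 0)"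
  proof (rule sum.cong[OF refl])
    fix S assume S: "S \<in> ?S"
    then have fin: "finite S" using finite_E by (auto intro: finite_subset)
    have sub: "leaf_edges S \<subseteq> S" by (auto simp: leaf_edges_def)
    \<comment> \<open>The sum over \<open>d\<close> starts at 1, so the inversion needs at least one
      leaf edge.\<close>
    have "leaf_edges S \<noteq> {}" using leaf_edges_nonempty S by blast
    then have "1 \<le> card (leaf_edges S)"
      using finite_subset[OF sub fin] by (simp add: Suc_le_eq card_gt_0_iff)
    moreover have "card (leaf_edges S) \<le> i" using card_mono[OF fin sub] S by simp
    ultimately show "(\<Sum>d = 1..j. ?c d * (if card (leaf_edges S) \<le> d
        then of_nat ((i - card (leaf_edges S)) choose (d - card (leaf_edges S))) else 0)) =
        (if j = card (leaf_edges S) then 1 else 0)"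
      using assms by (rule alternating_binomial_inversion)
  qed
  also have "\<dots> = of_nat (card {S. S \<subseteq> E \<and> tree_edge_set S \<and> card S = i \<and> card (leaf_edges S) = j})"
    using finS by (simp add: sum.If_cases Int_def conj_assoc eq_commute[of j])
  finally show ?thesis .
qed

text \<open>Both exponents are bounded by \<open>card E\<close>, because \<open>A\<close> and its
  connector together form a hull inside \<open>E\<close>.\<close>

lemma connector_poly_eq:
  "connector_poly E = (\<Sum>a = 1..card E. \<Sum>b = 0..card E. bivariate_monom
    (\<Sum>F\<in>Pow E. (-1) ^ card F * psi (component_type V F) (int a) (int b)) a b)"
proof -
  let ?X = "{A. A \<subseteq> E \<and> A \<noteq> {}}"
  have "connector_poly E = (\<Sum>a = 1..card E. \<Sum>b = 0..card E. bivariate_monom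
      (of_nat (card {A \<in> ?X. card A = a \<and> card (connector E A) = b})) a b)"
    unfolding connector_poly_def
  proof (rule sum_bivariate_monom_group)
    fix A assume A: "A \<in> ?X"
    then have "finite A" using finite_E by (auto intro: finite_subset)
    then have "card A > 0" using A by (simp add: card_gt_0_iff)
    moreover have "card (tree_hull A) \<le> card E" using tree_hull(1)[of A] A finite_E by (auto intro: card_mono)
    ultimately show "card A \<in> {1..card E} \<and> card (connector E A) \<in> {0..card E}"
      using card_connector[of A] A by auto
  qed (use finite_E in auto)
  also have "\<dots> = (\<Sum>a = 1..card E. \<Sum>b = 0..card E. bivariate_monom
      (\<Sum>F\<in>Pow E. (-1) ^ card F * psi (component_type V F) (int a) (int b)) a b)"
  proof (intro sum.cong refl)
    fix a b assume "a \<in> {1..card E}"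
    then have a: "a > 0" by simp
    have "{A \<in> ?X. card A = a \<and> card (connector E A) = b} =
        {A. A \<subseteq> E \<and> card A = a \<and> card (tree_hull A) = a + b}"
    proof (rule set_eqI)
      fix A
      show "A \<in> {A \<in> ?X. card A = a \<and> card (connector E A) = b} \<longleftrightarrow>
          A \<in> {A. A \<subseteq> E \<and> card A = a \<and> card (tree_hull A) = a + b}"
        using card_connector[of A] a by (cases "A = {}") auto
    qed
    then show "bivariate_monom (of_nat (card {A \<in> ?X. card A = a \<and> card (connector E A) = b})) a b =
        bivariate_monom (\<Sum>F\<in>Pow E. (-1) ^ card F * psi (component_type V F) (int a) (int b)) a b"
      by (simp only: sum_psi_component_type[OF a])
  qed
  finally show ?thesis .
qed

lemma subtree_poly_eq:
  "subtree_poly E = (\<Sum>i = 1..card E. \<Sum>j = 1..i. bivariate_monom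
    (\<Sum>F\<in>Pow E. (-1) ^ card F * phi (component_type V F) (int i) (int j)) i j)"
proof -
  let ?X = "{S. S \<subseteq> E \<and> tree_edge_set S}"
  have "subtree_poly E = (\<Sum>i = 1..card E. \<Sum>j = 1..i. bivariate_monom
      (of_nat (card {S \<in> ?X. card S = i \<and> card (leaf_edges S) = j})) i j)"
    unfolding subtree_poly_def
  proof (rule sum_bivariate_monom_group)
    fix S assume S: "S \<in> ?X"
    then have fin: "finite S" using finite_E by (auto intro: finite_subset)
    have sub: "leaf_edges S \<subseteq> S" by (auto simp: leaf_edges_def)
    have "card (leaf_edges S) > 0"
      using S leaf_edges_nonempty finite_subset[OF sub fin] by (auto simp: card_gt_0_iff)
    moreover have "card (leaf_edges S) \<le> card S" using fin sub by (rule card_mono)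
    moreover have "card S \<le> card E" using S finite_E by (auto intro: card_mono)
    ultimately show "card S \<in> {1..card E} \<and> card (leaf_edges S) \<in> {1..card S}" by auto
  qed (use finite_E in auto)
  also have "\<dots> = (\<Sum>i = 1..card E. \<Sum>j = 1..i. bivariate_monom
      (\<Sum>F\<in>Pow E. (-1) ^ card F * phi (component_type V F) (int i) (int j)) i j)"
    by (intro sum.cong refl) (simp add: sum_phi_component_type conj_assoc)
  finally show ?thesis .
qed

end

section \<open>From edge-set sums back to power sum coefficients\<close>

theorem theorem1:
  fixes V :: "'a set" and E :: "'a set set" and n :: nat
  assumes "n \<ge> 1" and "is_tree V E" and "card V = n"
  shows "connector_poly E =
      Sum_any (\<lambda>a. if a > 0 then
        Sum_any (\<lambda>b. bivariate_monom (\<Sum>lam\<in>partitions n. psi lam (int a) (int b) *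
            power_sum_coeff n (chromatic_symmetric_function V E) lam) a b)
        else 0) \<and>
    subtree_poly E =
      (\<Sum>i = 1..n - 1. \<Sum>j = 1..i.
        bivariate_monom (\<Sum>lam\<in>partitions n. phi lam (int i) (int j) *
          power_sum_coeff n (chromatic_symmetric_function V E) lam) i j)"
proof -
  have G: "simple_graph V E" using assms(2) by (simp add: is_tree_def)
  interpret tree V E
    by unfold_locales
      (use assms(2) in \<open>auto simp: is_tree_def simple_graph_def connected_graph_iff\<close>)
  have n: "n - 1 = card E" using card_E assms(3) by simp
  let ?c = "power_sum_coeff n (chromatic_symmetric_function V E)"
  let ?f = "\<lambda>a b. bivariate_monom (\<Sum>lam\<in>partitions n. psi lam (int a) (int b) * ?c lam) a b"
  note coeff = sum_power_sum_coeff_chromatic[OF G assms(3)]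
  \<comment> \<open>\<open>Sum_any\<close> is a true sum only on finite support, which this bound
    provides for both summation indices.\<close>
  have zero: "?f a b = 0" if "n \<le> a + b" for a b
  proof -
    have "psi lam (int a) (int b) = 0" if "lam \<in> partitions n" for lam
      using psi_eq_0[OF that, of "int a" "int b"] \<open>n \<le> a + b\<close> by simp
    then show ?thesis by simp
  qed
  have inner: "Sum_any (?f a) = (\<Sum>b = 0..card E. ?f a b)" for a
  proof (rule Sum_any.expand_superset)
    show "{b. ?f a b \<noteq> 0} \<subseteq> {0..card E}"
    proof
      fix b assume "b \<in> {b. ?f a b \<noteq> 0}"
      then have "\<not> n \<le> a + b" using zero by blast
      then show "b \<in> {0..card E}" using n by simp
    qed
  qed simp
  have "Sum_any (\<lambda>a. if a > 0 then Sum_any (?f a) else 0) =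
      (\<Sum>a = 1..card E. if a > 0 then Sum_any (?f a) else 0)"
  proof (rule Sum_any.expand_superset)
    show "{a. (if a > 0 then Sum_any (?f a) else 0) \<noteq> 0} \<subseteq> {1..card E}"
    proof
      fix a assume "a \<in> {a. (if a > 0 then Sum_any (?f a) else 0) \<noteq> 0}"
      then have a: "a > 0" "Sum_any (?f a) \<noteq> 0" by (auto split: if_splits)
      \<comment> \<open>For \<open>a \<ge> n\<close> every inner term already vanishes, so the outer
        sum also stops at \<open>n - 1 = card E\<close>.\<close>
      have "\<not> n \<le> a"
      proof
        assume "n \<le> a"
        then have "(\<Sum>b = 0..card E. ?f a b) = 0" by (intro sum.neutral ballI zero) simp
        then show False using a(2) inner by simp
      qed
      then show "a \<in> {1..card E}" using a(1) n by simp
    qed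
  qed simp
  also have "\<dots> = (\<Sum>a = 1..card E. \<Sum>b = 0..card E. ?f a b)"
    by (rule sum.cong) (auto simp: inner)
  also have "\<dots> = connector_poly E"
    unfolding connector_poly_eq by (simp only: coeff)
  finally have "connector_poly E = Sum_any (\<lambda>a. if a > 0 then Sum_any (?f a) else 0)" by simp
  moreover have "subtree_poly E = (\<Sum>i = 1..n - 1. \<Sum>j = 1..i.
      bivariate_monom (\<Sum>lam\<in>partitions n. phi lam (int i) (int j) * ?c lam) i j)"
    unfolding subtree_poly_eq n by (simp only: coeff)
  ultimately show ?thesis by blast
qed

end
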